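(* The number of vertices visited by simplex paths following Dantzig's pivot rule or the greatest improvement pivot rule is bounded by: (a) $m\left[ n\log(2n)\right]$ for the fractional perfect matching polytope on a graph with $n$ nodes and $m$ edges; for the complete graph $K_n$ this gives a bound $\sim\frac{n^3}{2}\log n$; (b) $m\left[ 2n\log(2n)\right]$ for the fractional matching polytope on a graph with $n$ nodes and $m$ edges; for the complete graph $K_n$ this gives a bound $\sim n^3\log n$; (c) $n^2\left[ n\log(2n-1)\right]\sim n^3\log n$ for the Birkhoff polytope on the bipartite graph $K_{n,n}$; (d) $(n^2-2n+1)\left[(n-1)\log(n-1)\right]\sim n^3\log n$ for the shortest path polytope on $n$ nodes.
   Context: $\log$ is the natural logarithm; $[y]$ denotes $y$ rounded up to an integer; $\sim$ denotes asymptotic equivalence as $n\to\infty$. For a graph $G=(V,E)$, with $x(\delta(v))$ the sum of $x_e$ over edges $e$ incident to $v$: the fractional perfect matching polytope is $\{x\in\mathbb{R}^E: x\ge0,\ x(\delta(v))=1\ \forall v\in V\}$; the fractional matching polytope is $\{x\in\mathbb{R}^E: x\ge0,\ x(\delta(v))\le1\ \forall v\in V\}$, put in standard form by adding one slack variable per node. The Birkhoff polytope on $K_{n,n}$ is the set of $x\in\mathbb{R}^{n\times n}$, $x\ge0$, with all row and column sums equal to 1 (its vertices are the perfect matchings of $K_{n,n}$). The shortest path polytope on $n$ nodes is the polytope of directed paths without cycles from node $1$ to node $n$, given by the system in variables $x_{i,j}\ge0$ ($1\le i\le n-1$, $2\le j\le n$, $i\ne j$) with $\sum_{j=2}^n x_{1,j}=1$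 and, for $2\le i\le n-1$, $\sum_{j\ne i}x_{i,j}-\sum_{j\ne i}x_{j,i}=0$ and $\sum_{j\neq i}x_{i,j}\le1$, the inequalities being put in standard form with slack variables. The simplex method is run from any starting vertex on the standard form LP $\min c^Tx$, $Ax=b$, $x\ge0$ (with $A$ of full row rank, redundant equations being removed), for any objective $c$ that is nondegenerate (no two vertices of the polytope have the same objective value). At a basic feasible solution (BFS) with basis $B$ and nonbasic columns $N$, the reduced costs are $\bar c_N^T=c_N^T-c_B^TB^{-1}N$; a nonbasic variable with negative reduced cost enters, and the leaving variable is determined by the ratio test. Dantzig's rule chooses the entering variable with most negative reduced cost; the greatest improvement rule chooses the one whose pivot gives the largest decrease of the objective. The number of vertices visited is the number of different BFS (as points) generated.
   Formalization: Greatest improvement compares the pivots from all bases of the current BFS (with one basis, stalling at degenerate vertices breaks the bound); single-point cases, where the printed bound is 0, are excluded: no nodes in (a), no edges in (b), n=1 in (c), n=2 in (d). *)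

theory Defs
  imports Complex_Main "HOL-Library.Landau_Symbols"
begin

section \<open>Linear programs in standard form\<close>

text \<open>The system \<open>A x = b\<close>, \<open>x \<ge> 0\<close>, with rows and columns indexed by arbitrary finite sets.
  A point is a function that vanishes outside the set of columns, so that equality of points is
  equality of functions.\<close>

record ('r, 'c) standard_form =
  row_set :: "'r set"
  col_set :: "'c set"
  entry :: "'r \<Rightarrow> 'c \<Rightarrow> real"
  rhs :: "'r \<Rightarrow> real"

definition solution_set :: "('r, 'c) standard_form \<Rightarrow> ('c \<Rightarrow> real) set" where
  "solution_set P =
     {x. (\<forall>j. j \<notin> col_set P \<longrightarrow> x j = 0) \<and> (\<forall>i\<in>row_set P. (\<Sum>j\<in>col_set P. entry P i j * x j) = rhs P i)}"

definition polytope_of :: "('r, 'c) standard_form \<Rightarrow> ('c \<Rightarrow> real) set" where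
  "polytope_of P = {x \<in> solution_set P. \<forall>j\<in>col_set P. 0 \<le> x j}"

definition vertices_of :: "('r, 'c) standard_form \<Rightarrow> ('c \<Rightarrow> real) set" where
  "vertices_of P =
     {x \<in> polytope_of P. \<forall>y\<in>polytope_of P. \<forall>z\<in>polytope_of P. \<forall>u. 0 < u \<and> u < 1 \<and>
        x = (\<lambda>j. (1 - u) * y j + u * z j) \<longrightarrow> y = x \<and> z = x}"

definition objective :: "('r, 'c) standard_form \<Rightarrow> ('c \<Rightarrow> real) \<Rightarrow> ('c \<Rightarrow> real) \<Rightarrow> real" where
  "objective P c x = (\<Sum>j\<in>col_set P. c j * x j)"

definition nondegenerate_objective :: "('r, 'c) standard_form \<Rightarrow> ('c \<Rightarrow> real) \<Rightarrow> bool" where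
  "nondegenerate_objective P c \<longleftrightarrow> inj_on (objective P c) (vertices_of P)"

definition full_row_rank :: "('r, 'c) standard_form \<Rightarrow> bool" where
  "full_row_rank P \<longleftrightarrow>
     (\<forall>y. (\<forall>j\<in>col_set P. (\<Sum>i\<in>row_set P. y i * entry P i j) = 0) \<longrightarrow> (\<forall>i\<in>row_set P. y i = 0))"

text \<open>\<open>Q\<close> arises from \<open>P\<close> by removing redundant equations until full row rank is reached.\<close>

definition irredundant_form ::
    "('r, 'c) standard_form \<Rightarrow> ('r, 'c) standard_form \<Rightarrow> bool" where
  "irredundant_form P Q \<longleftrightarrow>
     (\<exists>R \<subseteq> row_set P. Q = P\<lparr>row_set := R\<rparr>) \<and> solution_set Q = solution_set P \<and> full_row_rank Q"


section \<open>Bases and the simplex method\<close>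

text \<open>The definitions of this section are meant for systems of full row rank.\<close>

definition is_basis :: "('r, 'c) standard_form \<Rightarrow> 'c set \<Rightarrow> bool" where
  "is_basis P B \<longleftrightarrow> B \<subseteq> col_set P \<and> card B = card (row_set P) \<and>
     (\<forall>z. (\<forall>i\<in>row_set P. (\<Sum>j\<in>B. entry P i j * z j) = 0) \<longrightarrow> (\<forall>j\<in>B. z j = 0))"

text \<open>The inverse of the square matrix formed by the columns in \<open>B\<close>; only its entries in
  \<open>B \<times> row_set P\<close> are meaningful.\<close>

definition basis_inverse :: "('r, 'c) standard_form \<Rightarrow> 'c set \<Rightarrow> 'c \<Rightarrow> 'r \<Rightarrow> real" where
  "basis_inverse P B = (SOME M.
     (\<forall>i\<in>row_set P. \<forall>k\<in>row_set P. (\<Sum>j\<in>B. entry P i j * M j k) = (if i = k then 1 else 0)) \<and>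
     (\<forall>j\<in>B. \<forall>k\<in>B. (\<Sum>i\<in>row_set P. M j i * entry P i k) = (if j = k then 1 else 0)))"

definition basic_solution :: "('r, 'c) standard_form \<Rightarrow> 'c set \<Rightarrow> 'c \<Rightarrow> real" where
  "basic_solution P B j = (if j \<in> B then \<Sum>i\<in>row_set P. basis_inverse P B j i * rhs P i else 0)"

definition feasible_basis :: "('r, 'c) standard_form \<Rightarrow> 'c set \<Rightarrow> bool" where
  "feasible_basis P B \<longleftrightarrow> is_basis P B \<and> (\<forall>j\<in>B. 0 \<le> basic_solution P B j)"

text \<open>Entry \<open>k \<in> B\<close> of the vector \<open>B\<^sup>-\<^sup>1 A\<^sub>j\<close>.\<close>

definition pivot_column :: "('r, 'c) standard_form \<Rightarrow> 'c set \<Rightarrow> 'c \<Rightarrow> 'c \<Rightarrow> real" where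
  "pivot_column P B j k = (\<Sum>i\<in>row_set P. basis_inverse P B k i * entry P i j)"

definition reduced_cost ::
    "('r, 'c) standard_form \<Rightarrow> ('c \<Rightarrow> real) \<Rightarrow> 'c set \<Rightarrow> 'c \<Rightarrow> real" where
  "reduced_cost P c B j = c j - (\<Sum>k\<in>B. c k * pivot_column P B j k)"

text \<open>In a simplex pivot from \<open>B\<close> to \<open>B'\<close> the variable \<open>j\<close> enters and \<open>l\<close> leaves; ties in the
  ratio test may be broken arbitrarily.\<close>

definition simplex_pivot ::
    "('r, 'c) standard_form \<Rightarrow> ('c \<Rightarrow> real) \<Rightarrow> 'c set \<Rightarrow> 'c \<Rightarrow> 'c \<Rightarrow> 'c set \<Rightarrow> bool" where
  "simplex_pivot P c B j l B' \<longleftrightarrow>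
     feasible_basis P B \<and> j \<in> col_set P - B \<and> reduced_cost P c B j < 0 \<and>
     l \<in> B \<and> 0 < pivot_column P B j l \<and>
     (\<forall>k\<in>B. 0 < pivot_column P B j k \<longrightarrow>
        basic_solution P B l / pivot_column P B j l \<le> basic_solution P B k / pivot_column P B j k) \<and>
     B' = insert j (B - {l})"

definition dantzig_step ::
    "('r, 'c) standard_form \<Rightarrow> ('c \<Rightarrow> real) \<Rightarrow> 'c set \<Rightarrow> 'c set \<Rightarrow> bool" where
  "dantzig_step P c B B' \<longleftrightarrow>
     (\<exists>j l. simplex_pivot P c B j l B' \<and>
        (\<forall>k\<in>col_set P - B. reduced_cost P c B j \<le> reduced_cost P c B k))"

definition decrease :: "('r, 'c) standard_form \<Rightarrow> ('c \<Rightarrow> real) \<Rightarrow> 'c set \<Rightarrow> 'c set \<Rightarrow> real" where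
  "decrease P c B B' = objective P c (basic_solution P B) - objective P c (basic_solution P B')"

text \<open>The pivots available at the basic feasible solution of \<open>B\<close>. A degenerate basic feasible
  solution has several bases, and a pivot may be made from any of them.\<close>

definition bfs_pivot ::
    "('r, 'c) standard_form \<Rightarrow> ('c \<Rightarrow> real) \<Rightarrow> 'c set \<Rightarrow> 'c set \<Rightarrow> bool" where
  "bfs_pivot P c B B' \<longleftrightarrow>
     (\<exists>C j l. basic_solution P C = basic_solution P B \<and> simplex_pivot P c C j l B')"

text \<open>The greatest improvement rule compares all pivots available at the current basic feasible
  solution. If that solution is nondegenerate, \<open>B\<close> is its only basis and these are the pivots from
  \<open>B\<close>. At a degenerate solution the better pivots may all be blocked in the current basis. With the
  comparison confined to the pivots from a single basis there is no polynomial bound: even on the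
  fractional perfect matching polytopes of bipartite graphs, adversarial choices among pivots of
  decrease zero then lead through exponentially many vertices.\<close>

definition greatest_improvement_step ::
    "('r, 'c) standard_form \<Rightarrow> ('c \<Rightarrow> real) \<Rightarrow> 'c set \<Rightarrow> 'c set \<Rightarrow> bool" where
  "greatest_improvement_step P c B B' \<longleftrightarrow>
     bfs_pivot P c B B' \<and> (\<forall>D. bfs_pivot P c B D \<longrightarrow> decrease P c B D \<le> decrease P c B B')"

datatype pivot_rule = Dantzig | Greatest_Improvement

fun pivot_step ::
    "pivot_rule \<Rightarrow> ('r, 'c) standard_form \<Rightarrow> ('c \<Rightarrow> real) \<Rightarrow> 'c set \<Rightarrow> 'c set \<Rightarrow> bool" where
  "pivot_step Dantzig = dantzig_step"
| "pivot_step Greatest_Improvement = greatest_improvement_step"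

text \<open>Paths are finite but need not be maximal, so a bound for all paths also covers runs that
  cycle.\<close>

definition simplex_path ::
    "pivot_rule \<Rightarrow> ('r, 'c) standard_form \<Rightarrow> ('c \<Rightarrow> real) \<Rightarrow> 'c set list \<Rightarrow> bool" where
  "simplex_path rule P c Bs \<longleftrightarrow>
     Bs \<noteq> [] \<and> feasible_basis P (hd Bs) \<and> successively (pivot_step rule P c) Bs"

definition visited_vertices ::
    "('r, 'c) standard_form \<Rightarrow> 'c set list \<Rightarrow> ('c \<Rightarrow> real) set" where
  "visited_vertices P Bs = basic_solution P ` set Bs"

definition visits_at_most :: "('r, 'c) standard_form \<Rightarrow> int \<Rightarrow> bool" where
  "visits_at_most P N \<longleftrightarrow>
     (\<forall>Q c rule Bs. irredundant_form P Q \<and> nondegenerate_objective P c \<and> simplex_path rule Q c Bs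
        \<longrightarrow> int (card (visited_vertices Q Bs)) \<le> N)"


section \<open>The polytopes\<close>

definition simple_graph :: "'v set \<Rightarrow> 'v set set \<Rightarrow> bool" where
  "simple_graph V E \<longleftrightarrow> finite V \<and> (\<forall>e\<in>E. e \<subseteq> V \<and> card e = 2)"

definition complete_edges :: "'v set \<Rightarrow> 'v set set" where
  "complete_edges V = {e. e \<subseteq> V \<and> card e = 2}"

definition fractional_perfect_matching_lp :: "'v set \<Rightarrow> 'v set set \<Rightarrow> ('v, 'v set) standard_form" where
  "fractional_perfect_matching_lp V E =
     \<lparr>row_set = V, col_set = E, entry = (\<lambda>v e. if v \<in> e then 1 else 0), rhs = (\<lambda>v. 1)\<rparr>"

text \<open>\<open>Inl e\<close> is the variable of the edge \<open>e\<close> and \<open>Inr v\<close> the slack variable of the node \<open>v\<close>.\<close>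

definition fractional_matching_lp :: "'v set \<Rightarrow> 'v set set \<Rightarrow> ('v, 'v set + 'v) standard_form" where
  "fractional_matching_lp V E =
     \<lparr>row_set = V, col_set = E <+> V,
      entry = (\<lambda>v j. case j of Inl e \<Rightarrow> (if v \<in> e then 1 else 0) | Inr u \<Rightarrow> (if u = v then 1 else 0)),
      rhs = (\<lambda>v. 1)\<rparr>"

text \<open>\<open>Inl i\<close> is the equation of row \<open>i\<close> and \<open>Inr j\<close> that of column \<open>j\<close>.\<close>

definition birkhoff_lp :: "nat \<Rightarrow> (nat + nat, nat \<times> nat) standard_form" where
  "birkhoff_lp n =
     \<lparr>row_set = {1..n} <+> {1..n}, col_set = {1..n} \<times> {1..n},
      entry = (\<lambda>r (i, j). case r of Inl k \<Rightarrow> (if i = k then 1 else 0) | Inr k \<Rightarrow> (if j = k then 1 else 0)),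
      rhs = (\<lambda>r. 1)\<rparr>"

text \<open>\<open>Inl i\<close> is the flow equation of node \<open>i\<close> and \<open>Inr i\<close> the equation of its capacity
  constraint, with slack variable \<open>Inr i\<close>; \<open>Inl (i, j)\<close> is the variable of the arc from \<open>i\<close> to \<open>j\<close>.
  No arc enters node \<open>1\<close>, so that its flow equation has the same left-hand side as the others.\<close>

definition shortest_path_lp :: "nat \<Rightarrow> (nat + nat, nat \<times> nat + nat) standard_form" where
  "shortest_path_lp n =
     \<lparr>row_set = {1..n-1} <+> {2..n-1},
      col_set = {(i, j). i \<in> {1..n-1} \<and> j \<in> {2..n} \<and> i \<noteq> j} <+> {2..n-1},
      entry = (\<lambda>r v. case r of
               Inl k \<Rightarrow> (case v of Inl (i, j) \<Rightarrow> (if i = k then 1 else 0) - (if j = k then 1 else 0)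
                                | Inr i \<Rightarrow> 0)
             | Inr k \<Rightarrow> (case v of Inl (i, j) \<Rightarrow> (if i = k then 1 else 0)
                                | Inr i \<Rightarrow> (if i = k then 1 else 0))),
      rhs = (\<lambda>r. case r of Inl k \<Rightarrow> (if k = 1 then 1 else 0) | Inr k \<Rightarrow> 1)\<rparr>"

lemma simple_graph_finite: "simple_graph V E \<Longrightarrow> finite E"
  unfolding simple_graph_def by (rule finite_subset[of _ "Pow V"]) auto

lemma ball_Plus: "(\<forall>r\<in>A <+> B. Q r) \<longleftrightarrow> (\<forall>a\<in>A. Q (Inl a)) \<and> (\<forall>b\<in>B. Q (Inr b))"
  by blast

lemma sum_indicator_mult:
  fixes x :: "'a \<Rightarrow> real"
  assumes "finite A"
  shows "(\<Sum>a\<in>A. (if Q a then 1 else 0) * x a) = (\<Sum>a\<in>{a\<in>A. Q a}. x a)"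
  using assms by (simp add: sum.inter_filter if_distrib[of "\<lambda>t. t * _"] cong: if_cong)

lemma polytope_of_fractional_perfect_matching_lp:
  assumes "simple_graph V E"
  shows "polytope_of (fractional_perfect_matching_lp V E) =
    {x. (\<forall>e. e \<notin> E \<longrightarrow> x e = 0) \<and> (\<forall>e\<in>E. 0 \<le> x e) \<and> (\<forall>v\<in>V. (\<Sum>e\<in>{e\<in>E. v \<in> e}. x e) = 1)}"
  by (auto simp: polytope_of_def solution_set_def fractional_perfect_matching_lp_def
      sum_indicator_mult[OF simple_graph_finite[OF assms]])

lemma polytope_of_fractional_matching_lp:
  assumes "simple_graph V E"
  shows "polytope_of (fractional_matching_lp V E) =
    {x. (\<forall>j. j \<notin> E <+> V \<longrightarrow> x j = 0) \<and> (\<forall>j\<in>E <+> V. 0 \<le> x j) \<and>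
        (\<forall>v\<in>V. (\<Sum>e\<in>{e\<in>E. v \<in> e}. x (Inl e)) + x (Inr v) = 1)}"
proof -
  have fin: "finite E" "finite V"
    using simple_graph_finite[OF assms] assms by (auto simp: simple_graph_def)
  have "(\<Sum>j\<in>E <+> V. entry (fractional_matching_lp V E) v j * x j) =
      (\<Sum>e\<in>{e\<in>E. v \<in> e}. x (Inl e)) + x (Inr v)" if "v \<in> V" for x v
  proof -
    have "{u \<in> V. u = v} = {v}" using that by auto
    then have "(\<Sum>u\<in>V. (if u = v then 1 else 0) * x (Inr u)) = x (Inr v)"
      using sum_indicator_mult[OF fin(2), of "\<lambda>u. u = v" "\<lambda>u. x (Inr u)"] by (simp only: sum.insert sum.empty) simp
    then show ?thesis
      by (simp only: fractional_matching_lp_def standard_form.simps sum.Plus[OF fin] o_def sum.case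
          sum_indicator_mult[OF fin(1)])
  qed
  moreover have "row_set (fractional_matching_lp V E) = V" "col_set (fractional_matching_lp V E) = E <+> V"
    "rhs (fractional_matching_lp V E) = (\<lambda>v. 1)" by (simp_all add: fractional_matching_lp_def)
  ultimately show ?thesis
    by (auto simp only: polytope_of_def solution_set_def mem_Collect_eq)
qed

lemma polytope_of_birkhoff_lp:
  "polytope_of (birkhoff_lp n) =
    {x. (\<forall>p. p \<notin> {1..n} \<times> {1..n} \<longrightarrow> x p = 0) \<and> (\<forall>p\<in>{1..n} \<times> {1..n}. 0 \<le> x p) \<and>
        (\<forall>i\<in>{1..n}. (\<Sum>j\<in>{1..n}. x (i, j)) = 1) \<and> (\<forall>j\<in>{1..n}. (\<Sum>i\<in>{1..n}. x (i, j)) = 1)}"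
proof -
  define N where "N = {1..n}"
  have fin: "finite (N \<times> N)" by (simp add: N_def)
  have "(\<Sum>p\<in>N \<times> N. entry (birkhoff_lp n) (Inl k) p * x p) = (\<Sum>j\<in>N. x (k, j))"
    if "k \<in> N" for x k
  proof -
    have "(\<Sum>p\<in>N \<times> N. entry (birkhoff_lp n) (Inl k) p * x p) =
        (\<Sum>p\<in>N \<times> N. (if fst p = k then 1 else 0) * x p)"
      by (simp add: birkhoff_lp_def case_prod_unfold)
    also have "\<dots> = (\<Sum>p\<in>{p\<in>N \<times> N. fst p = k}. x p)"
      by (rule sum_indicator_mult[OF fin])
    also have "{p\<in>N \<times> N. fst p = k} = Pair k ` N" using that by auto
    also have "(\<Sum>p\<in>Pair k ` N. x p) = (\<Sum>j\<in>N. x (k, j))"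
      by (simp add: sum.reindex inj_on_def)
    finally show ?thesis .
  qed
  moreover have "(\<Sum>p\<in>N \<times> N. entry (birkhoff_lp n) (Inr k) p * x p) = (\<Sum>i\<in>N. x (i, k))"
    if "k \<in> N" for x k
  proof -
    have "(\<Sum>p\<in>N \<times> N. entry (birkhoff_lp n) (Inr k) p * x p) =
        (\<Sum>p\<in>N \<times> N. (if snd p = k then 1 else 0) * x p)"
      by (simp add: birkhoff_lp_def case_prod_unfold)
    also have "\<dots> = (\<Sum>p\<in>{p\<in>N \<times> N. snd p = k}. x p)"
      by (rule sum_indicator_mult[OF fin])
    also have "{p\<in>N \<times> N. snd p = k} = (\<lambda>i. (i, k)) ` N" using that by auto
    also have "(\<Sum>p\<in>(\<lambda>i. (i, k)) ` N. x p) = (\<Sum>i\<in>N. x (i, k))"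
      by (simp add: sum.reindex inj_on_def)
    finally show ?thesis .
  qed
  moreover have "row_set (birkhoff_lp n) = N <+> N" "col_set (birkhoff_lp n) = N \<times> N"
    "rhs (birkhoff_lp n) = (\<lambda>r. 1)" by (simp_all add: birkhoff_lp_def N_def)
  ultimately have "polytope_of (birkhoff_lp n) =
    {x. (\<forall>p. p \<notin> N \<times> N \<longrightarrow> x p = 0) \<and> (\<forall>p\<in>N \<times> N. 0 \<le> x p) \<and>
        (\<forall>i\<in>N. (\<Sum>j\<in>N. x (i, j)) = 1) \<and> (\<forall>j\<in>N. (\<Sum>i\<in>N. x (i, j)) = 1)}"
    by (auto simp only: polytope_of_def solution_set_def ball_Plus mem_Collect_eq)
  then show ?thesis by (simp only: N_def)
qed

text \<open>In the flow equation of node \<open>1\<close> the sum over the entering arcs is empty.\<close>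

lemma polytope_of_shortest_path_lp:
  fixes n :: nat
  defines "arcs \<equiv> {(i, j). i \<in> {1..n-1} \<and> j \<in> {2..n} \<and> i \<noteq> j}"
  shows "polytope_of (shortest_path_lp n) =
    {x. (\<forall>v. v \<notin> arcs <+> {2..n-1} \<longrightarrow> x v = 0) \<and> (\<forall>v\<in>arcs <+> {2..n-1}. 0 \<le> x v) \<and>
        (\<forall>k\<in>{1..n-1}. (\<Sum>a\<in>{a\<in>arcs. fst a = k}. x (Inl a)) - (\<Sum>a\<in>{a\<in>arcs. snd a = k}. x (Inl a))
           = (if k = 1 then 1 else 0)) \<and>
        (\<forall>k\<in>{2..n-1}. (\<Sum>a\<in>{a\<in>arcs. fst a = k}. x (Inl a)) + x (Inr k) = 1)}"
proof -
  define M where "M = {2..n-1}"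
  have "arcs \<subseteq> {1..n-1} \<times> {2..n}" by (auto simp: arcs_def)
  then have fin: "finite arcs" "finite M"
    unfolding M_def by (auto intro: finite_subset)
  have "(\<Sum>v\<in>arcs <+> M. entry (shortest_path_lp n) (Inl k) v * x v) =
      (\<Sum>a\<in>{a\<in>arcs. fst a = k}. x (Inl a)) - (\<Sum>a\<in>{a\<in>arcs. snd a = k}. x (Inl a))" for x k
    by (simp only: shortest_path_lp_def standard_form.simps sum.Plus[OF fin] o_def sum.case
        case_prod_unfold left_diff_distrib sum_subtractf sum_indicator_mult[OF fin(1)]) simp
  moreover have "(\<Sum>v\<in>arcs <+> M. entry (shortest_path_lp n) (Inr k) v * x v) =
      (\<Sum>a\<in>{a\<in>arcs. fst a = k}. x (Inl a)) + x (Inr k)" if "k \<in> M" for x k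
  proof -
    have "{i \<in> M. i = k} = {k}" using that by auto
    then show ?thesis
      by (simp only: shortest_path_lp_def standard_form.simps sum.Plus[OF fin] o_def sum.case
          case_prod_unfold sum_indicator_mult[OF fin(1)] sum_indicator_mult[OF fin(2)]) simp
  qed
  moreover have "row_set (shortest_path_lp n) = {1..n-1} <+> M" "col_set (shortest_path_lp n) = arcs <+> M"
    "\<And>k. rhs (shortest_path_lp n) (Inl k) = (if k = 1 then 1 else 0)"
    "\<And>k. rhs (shortest_path_lp n) (Inr k) = 1"
    by (simp_all add: shortest_path_lp_def M_def arcs_def)
  ultimately have "polytope_of (shortest_path_lp n) =
    {x. (\<forall>v. v \<notin> arcs <+> M \<longrightarrow> x v = 0) \<and> (\<forall>v\<in>arcs <+> M. 0 \<le> x v) \<and>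
        (\<forall>k\<in>{1..n-1}. (\<Sum>a\<in>{a\<in>arcs. fst a = k}. x (Inl a)) - (\<Sum>a\<in>{a\<in>arcs. snd a = k}. x (Inl a))
           = (if k = 1 then 1 else 0)) \<and>
        (\<forall>k\<in>M. (\<Sum>a\<in>{a\<in>arcs. fst a = k}. x (Inl a)) + x (Inr k) = 1)}"
    by (auto simp only: polytope_of_def solution_set_def ball_Plus mem_Collect_eq)
  then show ?thesis by (simp only: M_def)
qed

end

theory Submission
  imports Defs "HOL-Computational_Algebra.Polynomial" "HOL-Real_Asymp.Real_Asymp"
begin

text \<open>
  Following Kitahara and Mizuno, let \<open>L\<close> bound the sum of the coordinates on the polytope and let \<open>\<delta>\<close>
  bound the positive coordinates of its vertices from below. Every pivot of either rule that leaves
  the current vertex multiplies the gap to the optimum by at most \<open>1 - \<delta> / L\<close>. If \<open>B\<close> is an optimal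
  basis, then at every vertex with positive gap some positive variable outside \<open>B\<close> has a reduced cost of at
  least \<open>gap / L\<close>, and it vanishes as soon as the gap has shrunk by the factor \<open>\<delta> / L\<close>, that is after
  about \<open>(L / \<delta>) ln (L / \<delta>)\<close> further vertices; each variable outside \<open>B\<close> is used up only once.

  All four polytopes embed into a polytope of doubly stochastic matrices, with slack variables on the
  diagonal. Hall's theorem yields a permutation inside the support of a vertex, and as the vertex is
  determined by its support, it is integral (\<open>\<delta> = 1\<close>) or half-integral (\<open>\<delta> = 1 / 2\<close>).
\<close>

section \<open>Linear algebra over finite index sets\<close>

text \<open>Degeneracy shapes the proof. A pivot may leave the point where it is, so pivots cannot
  be counted; only those that move the point are, and each of them lowers the gap strictly. An
  optimal vertex may have bases with negative reduced costs, and a simplex run may cycle before it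
  meets a good one, so the basis with nonnegative reduced costs comes from a perturbed right-hand
  side. For Dantzig's rule the contraction is read off the current basis. Greatest improvement
  compares the pivots of all bases of the point, and one of these bases must be exhibited whose
  pivot is not degenerate and gains enough. The count is the number of nonbasic variables times
  \<open>K\<close>, plus 1 for the optimal vertex, where \<open>K\<close> is about
  \<open>\<Lambda> ln \<Lambda>\<close> with \<open>\<Lambda> = L / \<delta>\<close>, namely
  \<open>n\<close>, \<open>2 n\<close>, \<open>n\<close> and \<open>n - 1\<close> for the four
  polytopes. Bounding by all variables, basic ones included, makes room for the 1, except for
  fractional matchings, where only the nonbasic variables may be charged.\<close>

lemma underdetermined_homogeneous:
  fixes a :: "'r \<Rightarrow> 'c \<Rightarrow> real"
  assumes "finite R" "finite B" "card R < card B"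
  shows "\<exists>z. (\<exists>j\<in>B. z j \<noteq> 0) \<and> (\<forall>i\<in>R. (\<Sum>j\<in>B. a i j * z j) = 0)"
  using assms
proof (induction R arbitrary: B a rule: finite_induct)
  case empty
  then have "B \<noteq> {}" by auto
  then show ?case by (intro exI[of _ "\<lambda>_. 1"]) auto
next
  case (insert r R)
  show ?case
  proof (cases "\<forall>j\<in>B. a r j = 0")
    case True
    have "card R < card B" using insert by simp
    then obtain z where "\<exists>j\<in>B. z j \<noteq> 0" "\<forall>i\<in>R. (\<Sum>j\<in>B. a i j * z j) = 0"
      using insert.IH[of B a] insert.prems by auto
    with True show ?thesis by auto
  next
    case False
    then obtain j0 where j0: "j0 \<in> B" "a r j0 \<noteq> 0" by auto
    \<comment> \<open>Gaussian elimination: row \<open>r\<close> clears column \<open>j0\<close>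
      from the remaining rows, and the unknown of \<open>j0\<close> is recovered from row
      \<open>r\<close> afterwards.\<close>
    define a' where "a' i j = a i j - a i j0 * a r j / a r j0" for i j
    have "card R < card (B - {j0})" using insert.prems insert.hyps j0 by simp
    then obtain z where z: "\<exists>j\<in>B-{j0}. z j \<noteq> 0" "\<forall>i\<in>R. (\<Sum>j\<in>B-{j0}. a' i j * z j) = 0"
      using insert.IH[of "B-{j0}" a'] insert.prems by auto
    define s where "s = (\<Sum>j\<in>B-{j0}. a r j * z j)"
    define z' where "z' = z(j0 := - s / a r j0)"
    have split: "(\<Sum>j\<in>B. a i j * z' j) = (\<Sum>j\<in>B-{j0}. a i j * z j) - a i j0 * s / a r j0" for i
      using j0 insert.prems by (simp add: sum.remove[of B j0] z'_def)
    have "(\<Sum>j\<in>B-{j0}. a' i j * z j) = (\<Sum>j\<in>B-{j0}. a i j * z j) - a i j0 * s / a r j0" for i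
      unfolding a'_def s_def
      by (simp add: left_diff_distrib sum_subtractf sum_distrib_left sum_divide_distrib mult.assoc)
    with z(2) split have "\<forall>i\<in>R. (\<Sum>j\<in>B. a i j * z' j) = 0" by simp
    moreover have "(\<Sum>j\<in>B. a r j * z' j) = 0" using split[of r] j0 by (simp add: s_def)
    moreover have "\<exists>j\<in>B. z' j \<noteq> 0" using z(1) by (auto simp: z'_def)
    ultimately show ?thesis by (intro exI[of _ z']) auto
  qed
qed

lemma minimizer_exists:
  fixes f :: "'a \<Rightarrow> 'b :: linorder"
  assumes "finite S" "S \<noteq> {}"
  shows "\<exists>m\<in>S. \<forall>k\<in>S. f m \<le> f k"
  using arg_min_if_finite(1)[OF assms, of f] arg_min_least[OF assms, of _ f] by blast

section \<open>Independent columns, null vectors and bases\<close>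

definition independent_columns :: "('r, 'c) standard_form \<Rightarrow> 'c set \<Rightarrow> bool" where
  "independent_columns P B \<longleftrightarrow>
     (\<forall>z. (\<forall>i\<in>row_set P. (\<Sum>j\<in>B. entry P i j * z j) = 0) \<longrightarrow> (\<forall>j\<in>B. z j = 0))"

lemma independent_columnsD:
  "independent_columns P B \<Longrightarrow> (\<And>i. i \<in> row_set P \<Longrightarrow> (\<Sum>j\<in>B. entry P i j * z j) = 0)
    \<Longrightarrow> j \<in> B \<Longrightarrow> z j = 0"
  by (simp add: independent_columns_def)

text \<open>The kernel of the constraint matrix, extended by zero like the points; feasible
  directions and differences of solutions live here.\<close>

definition null_vector :: "('r, 'c) standard_form \<Rightarrow> ('c \<Rightarrow> real) \<Rightarrow> bool" where
  "null_vector P d \<longleftrightarrow> (\<forall>j. j \<notin> col_set P \<longrightarrow> d j = 0) \<and>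
     (\<forall>i\<in>row_set P. (\<Sum>j\<in>col_set P. entry P i j * d j) = 0)"

lemma is_basis_iff:
  "is_basis P B \<longleftrightarrow> B \<subseteq> col_set P \<and> card B = card (row_set P) \<and> independent_columns P B"
  by (simp add: is_basis_def independent_columns_def)

lemma basis_subset: "is_basis P B \<Longrightarrow> B \<subseteq> col_set P"
  by (simp add: is_basis_def)

locale finite_lp =
  fixes P :: "('r, 'c) standard_form"
  assumes finite_rows: "finite (row_set P)" and finite_cols: "finite (col_set P)"
begin

abbreviation "rows \<equiv> row_set P"
abbreviation "cols \<equiv> col_set P"

lemma finite_subcols: "B \<subseteq> cols \<Longrightarrow> finite B"
  using finite_cols finite_subset by blast

lemma sum_supported:
  assumes "B \<subseteq> cols" "\<And>j. j \<notin> B \<Longrightarrow> z j = 0"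
  shows "(\<Sum>j\<in>cols. f j * z j) = (\<Sum>j\<in>B. f j * (z j :: real))"
  by (rule sum.mono_neutral_right) (use assms finite_cols in auto)

lemma independent_columns_null_vector:
  assumes "B \<subseteq> cols" "independent_columns P B" "null_vector P z" "\<And>j. j \<notin> B \<Longrightarrow> z j = 0"
  shows "z j = 0"
  using assms sum_supported[of B z "entry P _"]
  by (cases "j \<in> B") (auto simp: independent_columns_def null_vector_def)

lemma independent_columnsI:
  assumes "B \<subseteq> cols"
    and "\<And>z. null_vector P z \<Longrightarrow> (\<And>j. j \<notin> B \<Longrightarrow> z j = 0) \<Longrightarrow> (\<And>j. z j = 0)"
  shows "independent_columns P B"
  unfolding independent_columns_def
proof (intro allI impI)
  fix z assume z: "\<forall>i\<in>rows. (\<Sum>j\<in>B. entry P i j * z j) = 0"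
  define z' where "z' j = (if j \<in> B then z j else 0)" for j
  have "null_vector P z'"
    using z assms(1) sum_supported[OF assms(1), of z' "entry P _"]
    by (auto simp: null_vector_def z'_def cong: sum.cong)
  then have "z' j = 0" for j using assms(2)[of z' j] by (auto simp: z'_def)
  then show "\<forall>j\<in>B. z j = 0" by (metis z'_def)
qed

lemma independent_columns_card_le:
  assumes "B \<subseteq> cols" "independent_columns P B"
  shows "card B \<le> card rows"
  using underdetermined_homogeneous[OF finite_rows finite_subcols[OF assms(1)], of "entry P"] assms(2)
  unfolding independent_columns_def by (meson not_le)

lemma finite_basis: "is_basis P B \<Longrightarrow> finite B"
  by (rule finite_subcols[OF basis_subset])

text \<open>With \<open>w\<close> adjoined as one more column, here \<open>None\<close>, there are
  more columns than rows and hence a nontrivial dependence. Independence of \<open>B\<close> forces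
  its coefficient at \<open>w\<close> to be nonzero, so one can divide by it.\<close>

lemma basis_solves:
  assumes B: "is_basis P B"
  obtains z where "\<And>j. j \<notin> B \<Longrightarrow> z j = 0" "\<And>i. i \<in> rows \<Longrightarrow> (\<Sum>j\<in>B. entry P i j * z j) = w i"
proof -
  have fin: "finite B" using B finite_basis by blast
  define a where "a i q = (case q of None \<Rightarrow> w i | Some j \<Rightarrow> entry P i j)" for i q
  have ins: "insert None (Some ` B) = {None} \<union> Some ` B" by auto
  have "card rows < card (insert None (Some ` B))"
    using B fin by (simp add: is_basis_def card_image card_insert_if image_iff)
  then obtain z where z: "\<exists>q\<in>insert None (Some ` B). z q \<noteq> 0"
      "\<forall>i\<in>rows. (\<Sum>q\<in>insert None (Some ` B). a i q * z q) = 0"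
    using underdetermined_homogeneous[OF finite_rows, of "insert None (Some ` B)" a] fin by auto
  have z2: "w i * z None + (\<Sum>j\<in>B. entry P i j * z (Some j)) = 0" if "i \<in> rows" for i
    using z(2) that fin by (auto simp: a_def sum.reindex image_iff)
  have "z None \<noteq> 0"
  proof
    assume 0: "z None = 0"
    then have "\<forall>j\<in>B. z (Some j) = 0"
      using z2 independent_columnsD[of P B "\<lambda>j. z (Some j)"] B by (simp add: is_basis_iff)
    with z(1) 0 show False by auto
  qed
  show ?thesis
  proof (rule that)
    fix i assume "i \<in> rows"
    have "(\<Sum>j\<in>B. entry P i j * (if j \<in> B then - z (Some j) / z None else 0))
        = - (\<Sum>j\<in>B. entry P i j * z (Some j)) / z None"
      by (simp add: sum_divide_distrib sum_negf)
    also have "\<dots> = w i" using z2[OF \<open>i \<in> rows\<close>] \<open>z None \<noteq> 0\<close> by (simp add: field_simps)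
    finally show "(\<Sum>j\<in>B. entry P i j * (if j \<in> B then - z (Some j) / z None else 0)) = w i" .
  qed simp
qed

text \<open>Justifies the choice in the definition. Solving for the unit vectors gives a right
  inverse; the columns of its product with the basis matrix minus the identity are annihilated by
  the independent columns, so it is a left inverse too.\<close>

lemma basis_inverse:
  assumes B: "is_basis P B"
  shows "\<And>i k. i \<in> rows \<Longrightarrow> k \<in> rows \<Longrightarrow>
      (\<Sum>j\<in>B. entry P i j * basis_inverse P B j k) = (if i = k then 1 else 0)"
    and "\<And>j k. j \<in> B \<Longrightarrow> k \<in> B \<Longrightarrow>
      (\<Sum>i\<in>rows. basis_inverse P B j i * entry P i k) = (if j = k then 1 else 0)"
proof -
  have fin: "finite B" using B finite_basis by blast
  have "\<exists>z. \<forall>i\<in>rows. (\<Sum>j\<in>B. entry P i j * z j) = (if i = k then 1 else 0)" for k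
    using basis_solves[OF B, of "\<lambda>i. if i = k then 1 else 0"] by metis
  then obtain M where M: "\<And>i k. i \<in> rows \<Longrightarrow> (\<Sum>j\<in>B. entry P i j * M k j) = (if i = k then 1 else 0)"
    by metis
  have left: "(\<Sum>i\<in>rows. M i j * entry P i k) = (if j = k then 1 else 0)" if "j \<in> B" "k \<in> B" for j k
  proof -
    define z where "z j = (\<Sum>i\<in>rows. M i j * entry P i k) - (if j = k then 1 else 0)" for j
    have "(\<Sum>j\<in>B. entry P i j * z j) = 0" if i: "i \<in> rows" for i
    proof -
      have "(\<Sum>j\<in>B. entry P i j * (\<Sum>i'\<in>rows. M i' j * entry P i' k))
          = (\<Sum>i'\<in>rows. (\<Sum>j\<in>B. entry P i j * M i' j) * entry P i' k)"
        unfolding sum_distrib_left sum_distrib_right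
        by (subst sum.swap) (simp add: mult.assoc)
      also have "\<dots> = (\<Sum>i'\<in>rows. if i' = i then entry P i' k else 0)"
        by (rule sum.cong) (auto simp: M[OF i])
      also have "\<dots> = entry P i k" using i finite_rows by simp
      finally have "(\<Sum>j\<in>B. entry P i j * (\<Sum>i'\<in>rows. M i' j * entry P i' k)) = entry P i k" .
      moreover have "(\<Sum>j\<in>B. entry P i j * (if j = k then 1 else 0)) = entry P i k"
        using \<open>k \<in> B\<close> fin by (simp add: if_distrib cong: if_cong)
      ultimately show ?thesis
        unfolding z_def right_diff_distrib sum_subtractf by simp
    qed
    then have "z j = 0" using B \<open>j \<in> B\<close> independent_columnsD[of P B z j] by (simp add: is_basis_iff)
    then show ?thesis by (simp add: z_def)
  qed
  have "\<exists>M. (\<forall>i\<in>rows. \<forall>k\<in>rows. (\<Sum>j\<in>B. entry P i j * M j k) = (if i = k then 1 else 0)) \<and>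
     (\<forall>j\<in>B. \<forall>k\<in>B. (\<Sum>i\<in>rows. M j i * entry P i k) = (if j = k then 1 else 0))"
    using M left by (intro exI[of _ "\<lambda>j k. M k j"]) auto
  from someI_ex[OF this]
  show "\<And>i k. i \<in> rows \<Longrightarrow> k \<in> rows \<Longrightarrow>
      (\<Sum>j\<in>B. entry P i j * basis_inverse P B j k) = (if i = k then 1 else 0)"
    and "\<And>j k. j \<in> B \<Longrightarrow> k \<in> B \<Longrightarrow>
      (\<Sum>i\<in>rows. basis_inverse P B j i * entry P i k) = (if j = k then 1 else 0)"
    unfolding basis_inverse_def by blast+
qed

text \<open>Let \<open>C\<close> be maximal independent above \<open>S\<close>. Were it too small,
  some nonzero \<open>y\<close> would be orthogonal to its columns; by maximality every other column
  is a combination of these, so \<open>y\<close> would be orthogonal to all columns, against full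
  row rank.\<close>

lemma extend_to_basis:
  assumes rank: "full_row_rank P" and "S \<subseteq> cols" "independent_columns P S"
  obtains B where "is_basis P B" "S \<subseteq> B"
proof -
  define F where "F = {C. S \<subseteq> C \<and> C \<subseteq> cols \<and> independent_columns P C}"
  have "finite F" unfolding F_def using finite_cols by simp
  moreover have "S \<in> F" using assms by (simp add: F_def)
  ultimately obtain C where C: "C \<in> F" and max: "\<And>D. D \<in> F \<Longrightarrow> C \<subseteq> D \<Longrightarrow> C = D"
    using finite_has_maximal by (metis empty_iff)
  have CF: "S \<subseteq> C" "C \<subseteq> cols" "independent_columns P C" using C by (auto simp: F_def)
  have fin: "finite C" using CF finite_subcols by blast
  have "card C = card rows"
  proof (rule ccontr)
    assume "card C \<noteq> card rows"
    then have "card C < card rows" using independent_columns_card_le[OF CF(2,3)] by simp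
    then obtain y where y: "\<exists>i\<in>rows. y i \<noteq> 0" "\<forall>j\<in>C. (\<Sum>i\<in>rows. entry P i j * y i) = 0"
      using underdetermined_homogeneous[OF fin finite_rows, of "\<lambda>j i. entry P i j"] by auto
    have "(\<Sum>i\<in>rows. y i * entry P i j) = 0" if j: "j \<in> cols" for j
    proof (cases "j \<in> C")
      case True then show ?thesis using y(2) by (simp add: mult.commute)
    next
      case False
      then have "insert j C \<notin> F" using max[of "insert j C"] by blast
      then have "\<not> independent_columns P (insert j C)" using CF j by (auto simp: F_def)
      then obtain z where z: "\<forall>i\<in>rows. (\<Sum>k\<in>insert j C. entry P i k * z k) = 0"
        "\<exists>k\<in>insert j C. z k \<noteq> 0" unfolding independent_columns_def by blast
      have zi: "entry P i j * z j = - (\<Sum>k\<in>C. entry P i k * z k)" if "i \<in> rows" for i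
        using z(1) that False fin by (simp add: eq_neg_iff_add_eq_0)
      have "z j \<noteq> 0"
      proof
        assume "z j = 0"
        then have "\<forall>k\<in>C. z k = 0" using zi independent_columnsD[OF CF(3), of z] by simp
        with z(2) \<open>z j = 0\<close> show False by auto
      qed
      have "(\<Sum>i\<in>rows. y i * entry P i j) * z j = - (\<Sum>i\<in>rows. y i * (\<Sum>k\<in>C. entry P i k * z k))"
        by (simp add: sum_distrib_right mult.assoc zi sum_negf)
      also have "(\<Sum>i\<in>rows. y i * (\<Sum>k\<in>C. entry P i k * z k))
          = (\<Sum>k\<in>C. (\<Sum>i\<in>rows. entry P i k * y i) * z k)"
        unfolding sum_distrib_left sum_distrib_right by (subst sum.swap) (simp add: ac_simps)
      also have "\<dots> = 0" using y(2) by simp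
      finally show ?thesis using \<open>z j \<noteq> 0\<close> by simp
    qed
    then show False using rank y(1) unfolding full_row_rank_def by blast
  qed
  then show ?thesis using that[of C] CF by (simp add: is_basis_iff)
qed

end

section \<open>Pivots\<close>

text \<open>The velocity of the point when the entering variable \<open>j\<close> grows at unit rate
  and all other nonbasic variables stay fixed.\<close>

definition pivot_direction :: "('r, 'c) standard_form \<Rightarrow> 'c set \<Rightarrow> 'c \<Rightarrow> 'c \<Rightarrow> real" where
  "pivot_direction P B j k = (if k = j then 1 else if k \<in> B then - pivot_column P B j k else 0)"

context finite_lp
begin

text \<open>The right-hand side \<open>w\<close> is left open so that \<open>w = rhs P\<close>
  covers solutions and \<open>w = 0\<close> covers null vectors.\<close>

lemma dictionary:
  assumes B: "is_basis P B" and z: "\<And>i. i \<in> rows \<Longrightarrow> (\<Sum>j\<in>cols. entry P i j * z j) = w i"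
    and k: "k \<in> B"
  shows "z k = (\<Sum>i\<in>rows. basis_inverse P B k i * w i) - (\<Sum>j\<in>cols - B. z j * pivot_column P B j k)"
proof -
  have sub: "B \<subseteq> cols" by (rule basis_subset[OF B])
  have "(\<Sum>i\<in>rows. basis_inverse P B k i * w i)
      = (\<Sum>i\<in>rows. basis_inverse P B k i * (\<Sum>j\<in>cols. entry P i j * z j))" using z by simp
  also have "\<dots> = (\<Sum>j\<in>cols. z j * pivot_column P B j k)"
    unfolding sum_distrib_left pivot_column_def by (subst sum.swap) (simp add: ac_simps)
  also have "\<dots> = (\<Sum>j\<in>cols - B. z j * pivot_column P B j k) + (\<Sum>j\<in>B. z j * pivot_column P B j k)"
    by (rule sum.subset_diff[OF sub finite_cols])
  also have "(\<Sum>j\<in>B. z j * pivot_column P B j k) = (\<Sum>j\<in>B. if j = k then z j else 0)"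
    using basis_inverse(2)[OF B k] by (intro sum.cong) (auto simp: pivot_column_def)
  finally show ?thesis using k finite_basis[OF B] by simp
qed

lemma solution_dictionary:
  assumes "is_basis P B" "x \<in> solution_set P" "k \<in> B"
  shows "x k = basic_solution P B k - (\<Sum>j\<in>cols - B. x j * pivot_column P B j k)"
  using dictionary[OF assms(1), of x "rhs P" k] assms by (auto simp: solution_set_def basic_solution_def)

lemma null_vector_dictionary:
  assumes "is_basis P B" "null_vector P d" "k \<in> B"
  shows "d k = - (\<Sum>j\<in>cols - B. d j * pivot_column P B j k)"
  using dictionary[OF assms(1), of d "\<lambda>_. 0" k] assms by (auto simp: null_vector_def)

lemma basic_solution_outside: "j \<notin> B \<Longrightarrow> basic_solution P B j = 0"
  by (simp add: basic_solution_def)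

lemma basic_solution_in_solution_set:
  assumes B: "is_basis P B"
  shows "basic_solution P B \<in> solution_set P"
proof -
  have sub: "B \<subseteq> cols" by (rule basis_subset[OF B])
  have "(\<Sum>j\<in>cols. entry P i j * basic_solution P B j) = rhs P i" if i: "i \<in> rows" for i
  proof -
    have "(\<Sum>j\<in>cols. entry P i j * basic_solution P B j) = (\<Sum>j\<in>B. entry P i j * basic_solution P B j)"
      by (rule sum_supported[OF sub]) (simp add: basic_solution_outside)
    also have "\<dots> = (\<Sum>j\<in>B. entry P i j * (\<Sum>k\<in>rows. basis_inverse P B j k * rhs P k))"
      by (simp add: basic_solution_def)
    also have "\<dots> = (\<Sum>k\<in>rows. (\<Sum>j\<in>B. entry P i j * basis_inverse P B j k) * rhs P k)"
      unfolding sum_distrib_left sum_distrib_right by (subst sum.swap) (simp add: ac_simps)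
    also have "\<dots> = (\<Sum>k\<in>rows. if k = i then rhs P k else 0)"
      using basis_inverse(1)[OF B i] by (intro sum.cong) auto
    finally show ?thesis using i finite_rows by simp
  qed
  then show ?thesis using sub by (auto simp: solution_set_def basic_solution_def)
qed

lemma basic_solution_unique:
  assumes B: "is_basis P B" and x: "x \<in> solution_set P" and supp: "\<And>j. j \<notin> B \<Longrightarrow> x j = 0"
  shows "x = basic_solution P B"
proof
  fix k
  show "x k = basic_solution P B k"
    using solution_dictionary[OF B x, of k] supp by (cases "k \<in> B") (simp_all add: basic_solution_outside)
qed

lemma feasible_basis_iff:
  "feasible_basis P B \<longleftrightarrow> is_basis P B \<and> basic_solution P B \<in> polytope_of P"
  by (auto simp: feasible_basis_def polytope_of_def is_basis_def basic_solution_in_solution_set)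
     (metis basic_solution_outside order_refl)

text \<open>As before, \<open>u\<close> is the basic solution for points and zero for
  directions.\<close>

lemma cost_dictionary:
  assumes B: "is_basis P B" and u: "\<And>j. j \<notin> B \<Longrightarrow> u j = 0"
    and z: "\<And>k. k \<in> B \<Longrightarrow> z k = u k - (\<Sum>j\<in>cols - B. z j * pivot_column P B j k)"
  shows "(\<Sum>j\<in>cols. c j * z j) = (\<Sum>j\<in>cols. c j * u j) + (\<Sum>j\<in>cols - B. reduced_cost P c B j * z j)"
proof -
  have sub: "B \<subseteq> cols" by (rule basis_subset[OF B])
  have "(\<Sum>k\<in>B. c k * z k) = (\<Sum>k\<in>B. c k * u k) - (\<Sum>k\<in>B. c k * (\<Sum>j\<in>cols - B. z j * pivot_column P B j k))"
    using z by (simp add: right_diff_distrib sum_subtractf)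
  also have "(\<Sum>k\<in>B. c k * (\<Sum>j\<in>cols - B. z j * pivot_column P B j k))
      = (\<Sum>j\<in>cols - B. (\<Sum>k\<in>B. c k * pivot_column P B j k) * z j)"
    unfolding sum_distrib_left sum_distrib_right by (subst sum.swap) (simp add: ac_simps)
  finally have "(\<Sum>k\<in>B. c k * z k) = (\<Sum>k\<in>B. c k * u k)
      - (\<Sum>j\<in>cols - B. (\<Sum>k\<in>B. c k * pivot_column P B j k) * z j)" .
  moreover have "(\<Sum>j\<in>cols. c j * z j) = (\<Sum>j\<in>cols - B. c j * z j) + (\<Sum>k\<in>B. c k * z k)"
    by (rule sum.subset_diff[OF sub finite_cols])
  moreover have "(\<Sum>j\<in>cols. c j * u j) = (\<Sum>k\<in>B. c k * u k)"
    by (rule sum_supported[OF sub u])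
  moreover have "(\<Sum>j\<in>cols - B. reduced_cost P c B j * z j) = (\<Sum>j\<in>cols - B. c j * z j)
      - (\<Sum>j\<in>cols - B. (\<Sum>k\<in>B. c k * pivot_column P B j k) * z j)"
    by (simp add: reduced_cost_def left_diff_distrib sum_subtractf)
  ultimately show ?thesis by simp
qed

lemma objective_dictionary:
  assumes "is_basis P B" "x \<in> solution_set P"
  shows "objective P c x =
    objective P c (basic_solution P B) + (\<Sum>j\<in>cols - B. reduced_cost P c B j * x j)"
  unfolding objective_def
  using cost_dictionary[OF assms(1) basic_solution_outside solution_dictionary[OF assms]] .

lemma null_vector_cost:
  assumes "is_basis P B" "null_vector P d"
  shows "objective P c d = (\<Sum>j\<in>cols - B. reduced_cost P c B j * d j)"
  unfolding objective_def
  using cost_dictionary[OF assms(1), of "\<lambda>_. 0" d c] null_vector_dictionary[OF assms] by simp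

lemma null_vector_pivot_direction:
  assumes B: "is_basis P B" and j: "j \<in> cols - B"
  shows "null_vector P (pivot_direction P B j)"
proof -
  have sub: "B \<subseteq> cols" by (rule basis_subset[OF B])
  have "(\<Sum>k\<in>cols. entry P i k * pivot_direction P B j k) = 0" if i: "i \<in> rows" for i
  proof -
    have "(\<Sum>k\<in>cols. entry P i k * pivot_direction P B j k)
        = (\<Sum>k\<in>insert j B. entry P i k * pivot_direction P B j k)"
      by (rule sum_supported) (use sub j in \<open>auto simp: pivot_direction_def\<close>)
    also have "\<dots> = entry P i j + (\<Sum>k\<in>B. entry P i k * pivot_direction P B j k)"
      using j finite_basis[OF B] by (simp add: pivot_direction_def)
    also have "(\<Sum>k\<in>B. entry P i k * pivot_direction P B j k)
        = - (\<Sum>k\<in>B. entry P i k * pivot_column P B j k)"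
      unfolding sum_negf[symmetric] using j by (intro sum.cong) (auto simp: pivot_direction_def)
    also have "(\<Sum>k\<in>B. entry P i k * pivot_column P B j k)
        = (\<Sum>i'\<in>rows. (\<Sum>k\<in>B. entry P i k * basis_inverse P B k i') * entry P i' j)"
      unfolding pivot_column_def sum_distrib_left sum_distrib_right by (subst sum.swap) (simp add: ac_simps)
    also have "\<dots> = (\<Sum>i'\<in>rows. if i' = i then entry P i' j else 0)"
      using basis_inverse(1)[OF B i] by (intro sum.cong) auto
    finally show ?thesis using i finite_rows by simp
  qed
  then show ?thesis using sub j by (auto simp: null_vector_def pivot_direction_def)
qed

lemma solution_set_add_null_vector:
  assumes "x \<in> solution_set P" "null_vector P d"
  shows "(\<lambda>j. x j + t * d j) \<in> solution_set P"
proof -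
  have "(\<Sum>j\<in>cols. entry P i j * (x j + t * d j))
      = (\<Sum>j\<in>cols. entry P i j * x j) + t * (\<Sum>j\<in>cols. entry P i j * d j)" for i
    by (simp add: distrib_left sum.distrib sum_distrib_left ac_simps)
  then show ?thesis using assms by (simp add: solution_set_def null_vector_def)
qed

lemma
  assumes piv: "simplex_pivot P c B j l B'"
  defines "\<theta> \<equiv> basic_solution P B l / pivot_column P B j l"
  shows pivot_length_nonneg: "0 \<le> \<theta>"
    and pivot_feasible: "feasible_basis P B'"
    and pivot_basic_solution: "basic_solution P B' = (\<lambda>k. basic_solution P B k + \<theta> * pivot_direction P B j k)"
    and pivot_entering_value: "basic_solution P B' j = \<theta>"
    and pivot_objective: "objective P c (basic_solution P B') =
      objective P c (basic_solution P B) + \<theta> * reduced_cost P c B j"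
proof -
  let ?x = "basic_solution P B" and ?d = "pivot_direction P B j"
  have fB: "feasible_basis P B" and j: "j \<in> cols - B" and l: "l \<in> B" "0 < pivot_column P B j l"
    and ratio: "\<And>k. k \<in> B \<Longrightarrow> 0 < pivot_column P B j k \<Longrightarrow> \<theta> \<le> ?x k / pivot_column P B j k"
    and B': "B' = insert j (B - {l})"
    using piv by (auto simp: simplex_pivot_def \<theta>_def)
  have B: "is_basis P B" and xB: "\<And>k. 0 \<le> ?x k"
    using fB by (auto simp: feasible_basis_def basic_solution_def)
  have sub: "B \<subseteq> cols" "B' \<subseteq> cols" using basis_subset[OF B] B' j by auto
  show th: "0 \<le> \<theta>" using xB[of l] l by (simp add: \<theta>_def)
  \<comment> \<open>A null vector supported on \<open>B'\<close> vanishes at \<open>l\<close>. As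
    the pivot entry at \<open>l\<close> is positive, its coordinate \<open>j\<close> vanishes as
    well, and with it all the others.\<close>
  have "independent_columns P B'"
  proof (rule independent_columnsI[OF sub(2)])
    fix z k
    assume z: "null_vector P z" "\<And>k. k \<notin> B' \<Longrightarrow> z k = 0"
    have "(\<Sum>i\<in>cols - B. z i * pivot_column P B i k) = z j * pivot_column P B j k" for k
      using z(2) j finite_cols B'
      by (subst sum.remove[of _ j]) (auto intro!: sum.neutral)
    then have zk: "z k = - z j * pivot_column P B j k" if "k \<in> B" for k
      using null_vector_dictionary[OF B z(1) that] by simp
    have "z l = 0" using B' l j by (intro z(2)) auto
    then have "z j = 0" using zk[OF l(1)] l(2) by simp
    then show "z k = 0" using zk[of k] z(2)[of k] B' by auto
  qed
  moreover have "card B' = card rows"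
    using card_Suc_Diff1[OF finite_basis[OF B] l(1)] B j finite_basis[OF B] by (simp add: B' is_basis_iff)
  ultimately have bB': "is_basis P B'" using sub by (simp add: is_basis_iff)
  \<comment> \<open>At step length \<open>\<theta>\<close> the leaving variable reaches 0, so the
    shifted point is supported on \<open>B'\<close> and must be its basic solution.\<close>
  have "?x l + \<theta> * ?d l = 0" using l j by (auto simp: pivot_direction_def \<theta>_def)
  then have "?x k + \<theta> * ?d k = 0" if "k \<notin> B'" for k
    using that by (cases "k = l") (auto simp: B' basic_solution_outside pivot_direction_def)
  then show sol: "basic_solution P B' = (\<lambda>k. ?x k + \<theta> * ?d k)"
    using basic_solution_unique[OF bB'
        solution_set_add_null_vector[OF basic_solution_in_solution_set[OF B] null_vector_pivot_direction[OF B j]]]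
    by metis
  \<comment> \<open>The ratio test guards the coordinates that decrease; the others cannot become
    negative.\<close>
  have "0 \<le> ?x k + \<theta> * ?d k" for k
  proof (cases "k \<in> B \<and> 0 < pivot_column P B j k")
    case True
    then show ?thesis using ratio[of k] j by (auto simp: pivot_direction_def field_simps)
  next
    case False
    then have "0 \<le> ?d k" using j by (auto simp: pivot_direction_def)
    then show ?thesis using xB[of k] th by simp
  qed
  then show "feasible_basis P B'" using bB' by (simp add: feasible_basis_def sol)
  show xj: "basic_solution P B' j = \<theta>"
    using j by (simp add: sol basic_solution_outside pivot_direction_def)
  have "(\<Sum>k\<in>cols - B. reduced_cost P c B k * basic_solution P B' k) = \<theta> * reduced_cost P c B j"
    using j finite_cols B' xj by (subst sum.remove[of _ j]) (auto intro!: sum.neutral simp: basic_solution_outside)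
  then show "objective P c (basic_solution P B') = objective P c ?x + \<theta> * reduced_cost P c B j"
    using objective_dictionary[OF B basic_solution_in_solution_set[OF bB'], of c] by simp
qed

text \<open>If no basic variable blocked the entering one, the pivot direction would be a
  nonnegative ray.\<close>

lemma pivot_exists:
  assumes fB: "feasible_basis P B" and j: "j \<in> cols - B" and neg: "reduced_cost P c B j < 0"
    and no_ray: "\<And>d k. null_vector P d \<Longrightarrow> (\<And>k. 0 \<le> d k) \<Longrightarrow> d k = 0"
  obtains l B' where "simplex_pivot P c B j l B'"
proof -
  have B: "is_basis P B" using fB by (simp add: feasible_basis_def)
  define S where "S = {k\<in>B. 0 < pivot_column P B j k}"
  define f where "f k = basic_solution P B k / pivot_column P B j k" for k
  have "S \<noteq> {}"
  proof
    assume "S = {}"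
    then have "0 \<le> pivot_direction P B j k" for k
      by (auto simp: S_def pivot_direction_def not_less)
    from no_ray[OF null_vector_pivot_direction[OF B j] this, of j] show False
      by (simp add: pivot_direction_def)
  qed
  moreover have "finite S" using finite_basis[OF B] by (simp add: S_def)
  ultimately obtain l where "l \<in> S" "\<And>k. k \<in> S \<Longrightarrow> f l \<le> f k"
    using minimizer_exists[of S f] by blast
  then have "simplex_pivot P c B j l (insert j (B - {l}))"
    using fB j neg by (auto simp: simplex_pivot_def S_def f_def)
  then show ?thesis by (rule that)
qed

end

section \<open>Existence of an optimal basis\<close>

lemma eventually_poly_nonzero_at_right:
  fixes p :: "real poly"
  assumes "p \<noteq> 0"
  shows "eventually (\<lambda>t. poly p t \<noteq> 0) (at_right a)"
  unfolding eventually_at_topological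
proof (intro exI conjI)
  show "open (- ({t. poly p t = 0} - {a}))"
    using poly_roots_finite[OF assms] by (intro open_Compl finite_imp_closed) simp
qed auto

text \<open>Perturbing the right-hand side by \<open>\<Sum>\<^sub>k t\<^bsup>k + 1\<^esup> A\<^sub>k\<close> over the columns of a feasible basis makes
  every basic solution nondegenerate for small \<open>t > 0\<close>, without making any infeasible basis feasible.
  In the perturbed program a best feasible basis admits no improving pivot.\<close>

lemma (in finite_lp) optimal_basis_exists:
  assumes fB0: "feasible_basis P B0"
    and no_ray: "\<And>d k. null_vector P d \<Longrightarrow> (\<And>k. 0 \<le> d k) \<Longrightarrow> d k = 0"
  obtains B where "feasible_basis P B" "\<And>j. j \<in> cols - B \<Longrightarrow> 0 \<le> reduced_cost P c B j"
proof -
  have B0: "is_basis P B0" using fB0 by (simp add: feasible_basis_def)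
  have sub0: "B0 \<subseteq> cols" and fin0: "finite B0" using basis_subset[OF B0] finite_basis[OF B0] by auto
  obtain idx :: "'c \<Rightarrow> nat" where idx: "inj_on idx B0"
    using finite_imp_inj_to_nat_seg[OF fin0] by metis
  \<comment> \<open>The value at \<open>t\<close> is coordinate \<open>j\<close> of the basic
    solution of \<open>B\<close> in the perturbed program. The exponents are distinct, so the
    perturbing columns cannot cancel, and positive, so that \<open>t = 0\<close> gives back the
    original program.\<close>
  define p where "p B j = [:basic_solution P B j:]
      + (\<Sum>k\<in>B0. monom (pivot_column P B k j) (Suc (idx k)))" for B j
  have p0: "poly (p B j) 0 = basic_solution P B j" for B j
    by (simp add: p_def poly_sum poly_monom)
  have p_nz: "p B j \<noteq> 0" if B: "is_basis P B" and j: "j \<in> B" for B j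
  proof -
    \<comment> \<open>The columns of \<open>B0\<close> span, so row \<open>j\<close> of the inverse
      of \<open>B\<close> would be zero if it annihilated all of them.\<close>
    have "\<exists>k\<in>B0. pivot_column P B k j \<noteq> 0"
    proof (rule ccontr)
      assume "\<not> ?thesis"
      then have 0: "(\<Sum>i\<in>rows. basis_inverse P B j i * entry P i k) = 0" if "k \<in> B0" for k
        using that by (simp add: pivot_column_def)
      have "basis_inverse P B j i' = 0" if i': "i' \<in> rows" for i'
      proof -
        have "basis_inverse P B j i' = (\<Sum>i\<in>rows. basis_inverse P B j i * (if i = i' then 1 else 0))"
          using i' finite_rows by (simp add: if_distrib cong: if_cong)
        also have "\<dots> = (\<Sum>i\<in>rows. basis_inverse P B j i * (\<Sum>k\<in>B0. entry P i k * basis_inverse P B0 k i'))"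
          using basis_inverse(1)[OF B0 _ i'] by (intro sum.cong) auto
        also have "\<dots> = (\<Sum>k\<in>B0. (\<Sum>i\<in>rows. basis_inverse P B j i * entry P i k) * basis_inverse P B0 k i')"
          unfolding sum_distrib_left sum_distrib_right by (subst sum.swap) (simp add: ac_simps)
        also have "\<dots> = 0" using 0 by simp
        finally show ?thesis .
      qed
      then show False using basis_inverse(2)[OF B j j] by simp
    qed
    then obtain k where k: "k \<in> B0" "pivot_column P B k j \<noteq> 0" by blast
    have "coeff (p B j) (Suc (idx k)) = (\<Sum>k'\<in>B0. if k' = k then pivot_column P B k' j else 0)"
      using idx k(1) by (auto simp: p_def coeff_sum coeff_pCons inj_on_eq_iff intro!: sum.cong)
    also have "\<dots> = pivot_column P B k j" using k(1) fin0 by simp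
    finally show ?thesis using k(2) by auto
  qed
  define bases where "bases = {B. is_basis P B}"
  have fin_bases: "finite bases"
    unfolding bases_def using finite_cols
    by (intro finite_subset[of "{B. is_basis P B}" "Pow cols"]) (auto dest: basis_subset)
  \<comment> \<open>There are finitely many bases, so one \<open>t\<close> serves all. As negative
    basic values stay negative, a basis that is feasible for the perturbed program is feasible for
    the original one.\<close>
  have "eventually (\<lambda>t. \<forall>B\<in>bases. \<forall>j\<in>B. poly (p B j) t \<noteq> 0 \<and>
      (basic_solution P B j < 0 \<longrightarrow> poly (p B j) t < 0)) (at_right 0)"
  proof (intro eventually_ball_finite ballI fin_bases)
    fix B j assume "B \<in> bases" "j \<in> B"
    then have B: "is_basis P B" "j \<in> B" by (auto simp: bases_def)
    have lim: "(poly (p B j) \<longlongrightarrow> basic_solution P B j) (at_right 0)"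
      unfolding p0[symmetric] by (intro tendsto_poly tendsto_ident_at)
    show "eventually (\<lambda>t. poly (p B j) t \<noteq> 0 \<and>
        (basic_solution P B j < 0 \<longrightarrow> poly (p B j) t < 0)) (at_right 0)"
      using eventually_poly_nonzero_at_right[OF p_nz[OF B]] order_tendstoD(2)[OF lim, of 0]
      by (cases "basic_solution P B j < 0") (auto intro: eventually_conj)
  qed (use finite_basis in \<open>auto simp: bases_def\<close>)
  from eventually_happens'[OF _ eventually_conj[OF this eventually_at_right_less[of 0]]]
  obtain t where t: "0 < t" "\<And>B j. is_basis P B \<Longrightarrow> j \<in> B \<Longrightarrow> poly (p B j) t \<noteq> 0"
      "\<And>B j. is_basis P B \<Longrightarrow> j \<in> B \<Longrightarrow> basic_solution P B j < 0 \<Longrightarrow> poly (p B j) t < 0"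
    by (auto simp: bases_def)
  define Q where "Q = P\<lparr>rhs := \<lambda>i. rhs P i + (\<Sum>k\<in>B0. t ^ Suc (idx k) * entry P i k)\<rparr>"
  have Q: "row_set Q = rows" "col_set Q = cols" "entry Q = entry P" by (simp_all add: Q_def)
  have Qb: "is_basis Q = is_basis P" "basis_inverse Q = basis_inverse P"
    by (simp_all add: fun_eq_iff is_basis_def basis_inverse_def Q)
  have Qp: "pivot_column Q = pivot_column P"
    by (simp add: fun_eq_iff pivot_column_def Q Qb)
  have Qr: "reduced_cost Q = reduced_cost P" "null_vector Q = null_vector P"
    by (simp_all add: fun_eq_iff reduced_cost_def null_vector_def Q Qp)
  interpret Q: finite_lp Q by unfold_locales (simp_all add: Q finite_rows finite_cols)
  have bsQ: "basic_solution Q B j = poly (p B j) t" if "j \<in> B" for B j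
  proof -
    have "(\<Sum>i\<in>rows. basis_inverse P B j i * (\<Sum>k\<in>B0. t ^ Suc (idx k) * entry P i k))
        = (\<Sum>k\<in>B0. pivot_column P B k j * t ^ Suc (idx k))"
      unfolding pivot_column_def sum_distrib_left sum_distrib_right
      by (subst sum.swap) (simp add: ac_simps)
    then show ?thesis
      using that unfolding basic_solution_def Qb Q
      by (simp add: Q_def p_def poly_sum poly_monom distrib_left sum.distrib basic_solution_def)
  qed
  \<comment> \<open>In the coordinates of \<open>B0\<close> itself the perturbing columns are unit
    vectors, so every basic value grows.\<close>
  have "feasible_basis Q B0"
    unfolding feasible_basis_def Qb
  proof (intro conjI ballI B0)
    fix j assume j: "j \<in> B0"
    have "(\<Sum>k\<in>B0. pivot_column P B0 k j * t ^ Suc (idx k)) = (\<Sum>k\<in>B0. if k = j then t ^ Suc (idx k) else 0)"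
      using basis_inverse(2)[OF B0 j] by (intro sum.cong) (auto simp: pivot_column_def)
    also have "\<dots> = t ^ Suc (idx j)" using j fin0 by simp
    finally have "basic_solution Q B0 j = basic_solution P B0 j + t ^ Suc (idx j)"
      unfolding bsQ[OF j] by (simp add: p_def poly_sum poly_monom)
    moreover have "0 \<le> basic_solution P B0 j" using fB0 j by (simp add: feasible_basis_def)
    moreover have "0 < t ^ Suc (idx j)" using t(1) by simp
    ultimately show "0 \<le> basic_solution Q B0 j" by linarith
  qed
  moreover have "finite {B. feasible_basis Q B}"
    using fin_bases by (rule rev_finite_subset) (auto simp: bases_def feasible_basis_def Qb)
  ultimately obtain B where fQ: "feasible_basis Q B"
    and min: "\<And>B'. feasible_basis Q B' \<Longrightarrow> objective Q c (basic_solution Q B) \<le> objective Q c (basic_solution Q B')"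
    using minimizer_exists[of "{B. feasible_basis Q B}" "\<lambda>B. objective Q c (basic_solution Q B)"] by blast
  have B: "is_basis P B" using fQ by (simp add: feasible_basis_def Qb)
  show ?thesis
  proof (rule that)
    have "\<not> basic_solution P B j < 0" if j: "j \<in> B" for j
      using t(3)[OF B j] bsQ[OF j] fQ j by (auto simp: feasible_basis_def)
    then show "feasible_basis P B" using B by (auto simp: feasible_basis_def not_less)
  next
    fix j assume j: "j \<in> cols - B"
    show "0 \<le> reduced_cost P c B j"
    proof (rule ccontr)
      assume "\<not> 0 \<le> reduced_cost P c B j"
      then have neg: "reduced_cost Q c B j < 0" by (simp add: Qr)
      obtain l B' where piv: "simplex_pivot Q c B j l B'"
        using Q.pivot_exists[OF fQ _ neg] j no_ray unfolding Q Qr by blast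
      have l: "l \<in> B" "0 < pivot_column Q B j l" using piv by (auto simp: simplex_pivot_def)
      \<comment> \<open>Nondegeneracy makes the step length positive, so the pivot would lower an
        objective that is already minimal.\<close>
      have "0 < basic_solution Q B l"
        using t(2)[OF B l(1)] bsQ[OF l(1)] fQ l(1) by (auto simp: feasible_basis_def less_le)
      then have "basic_solution Q B l / pivot_column Q B j l * reduced_cost Q c B j < 0"
        using l(2) neg by (intro mult_pos_neg divide_pos_pos)
      then show False
        using min[OF Q.pivot_feasible[OF piv]] Q.pivot_objective[OF piv] by simp
    qed
  qed
qed

section \<open>Geometric decrease of the optimality gap\<close>

text \<open>The grain is required of basic feasible solutions, the only points that pivots produce;
  \<open>\<delta> \<le> L\<close> keeps the contraction factor nonnegative.\<close>

locale bounded_lp = finite_lp +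
  fixes L \<delta> :: real
  assumes rank: "full_row_rank P"
    and sum_le: "x \<in> polytope_of P \<Longrightarrow> (\<Sum>j\<in>cols. x j) \<le> L"
    and grain: "feasible_basis P B \<Longrightarrow> 0 < basic_solution P B j \<Longrightarrow> \<delta> \<le> basic_solution P B j"
    and delta: "0 < \<delta>" "\<delta> \<le> L"
begin

lemma L_pos: "0 < L"
  using delta by linarith

lemma polytope_nonneg: "x \<in> polytope_of P \<Longrightarrow> 0 \<le> x j"
  by (cases "j \<in> cols") (auto simp: polytope_of_def solution_set_def)

lemma partial_sum_le: "x \<in> polytope_of P \<Longrightarrow> S \<subseteq> cols \<Longrightarrow> (\<Sum>j\<in>S. x j) \<le> L"
  using sum_mono2[OF finite_cols, of S x] sum_le[of x] polytope_nonneg[of x] by fastforce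

lemma no_ray:
  assumes x: "x \<in> polytope_of P" and d: "null_vector P d" "\<And>k. 0 \<le> d k"
  shows "d k = 0"
proof (rule ccontr)
  assume "d k \<noteq> 0"
  then have k: "k \<in> cols" "0 < d k" using d by (auto simp: null_vector_def less_le)
  \<comment> \<open>With this length coordinate \<open>k\<close> grows by \<open>2 * L\<close>,
    beyond what the bound allows.\<close>
  define t where "t = 2 * L / d k"
  have t: "0 \<le> t" using k L_pos by (simp add: t_def)
  have "x \<in> solution_set P" using x by (simp add: polytope_of_def)
  then have "(\<lambda>j. x j + t * d j) \<in> polytope_of P"
    using solution_set_add_null_vector[of x d t] polytope_nonneg[OF x] d t
    by (simp add: polytope_of_def)
  then have "(\<Sum>j\<in>{k}. x j + t * d j) \<le> L" by (rule partial_sum_le) (use k in simp)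
  then have "x k + 2 * L \<le> L" using k by (simp add: t_def)
  then show False using L_pos polytope_nonneg[OF x, of k] by simp
qed

end

section \<open>The gap relative to a fixed optimal basis\<close>

locale lp_with_optimal_basis = bounded_lp +
  fixes c Bopt
  assumes feasible_opt: "feasible_basis P Bopt"
    and reduced_cost_nonneg: "j \<in> cols - Bopt \<Longrightarrow> 0 \<le> reduced_cost P c Bopt j"
begin

definition "gap x = objective P c x - objective P c (basic_solution P Bopt)"

lemma basis_opt: "is_basis P Bopt" and opt_in_polytope: "basic_solution P Bopt \<in> polytope_of P"
  using feasible_opt by (simp_all add: feasible_basis_iff)

lemma gap_eq:
  "x \<in> polytope_of P \<Longrightarrow> gap x = (\<Sum>j\<in>cols - Bopt. reduced_cost P c Bopt j * x j)"
  using objective_dictionary[OF basis_opt, of x c] by (simp add: gap_def polytope_of_def)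

lemma gap_nonneg: "x \<in> polytope_of P \<Longrightarrow> 0 \<le> gap x"
  using reduced_cost_nonneg polytope_nonneg by (auto simp: gap_eq intro!: sum_nonneg)

lemma reduced_cost_le_gap:
  assumes "x \<in> polytope_of P" "j \<in> cols - Bopt"
  shows "reduced_cost P c Bopt j * x j \<le> gap x"
  unfolding gap_eq[OF assms(1)]
  by (rule member_le_sum) (use assms reduced_cost_nonneg polytope_nonneg finite_cols in auto)

text \<open>The optimum is read in the dictionary of \<open>B\<close>: its coordinates sum to at
  most \<open>L\<close>, and each unit of a nonbasic variable saves at most
  \<open>- r\<close>.\<close>

lemma gap_le_reduced_cost:
  assumes fB: "feasible_basis P B" and neg: "r \<le> 0"
    and r: "\<And>k. k \<in> cols - B \<Longrightarrow> r \<le> reduced_cost P c B k"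
  shows "gap (basic_solution P B) \<le> - r * L"
proof -
  let ?y = "basic_solution P Bopt"
  have B: "is_basis P B" using fB by (simp add: feasible_basis_def)
  have "- gap (basic_solution P B) = (\<Sum>k\<in>cols - B. reduced_cost P c B k * ?y k)"
    using objective_dictionary[OF B, of ?y c] opt_in_polytope by (simp add: gap_def polytope_of_def)
  also have "\<dots> \<ge> (\<Sum>k\<in>cols - B. r * ?y k)"
    using r polytope_nonneg[OF opt_in_polytope] by (intro sum_mono mult_right_mono)
  also have "(\<Sum>k\<in>cols - B. r * ?y k) = r * (\<Sum>k\<in>cols - B. ?y k)"
    by (simp add: sum_distrib_left)
  finally have "gap (basic_solution P B) \<le> - r * (\<Sum>k\<in>cols - B. ?y k)" by simp
  also have "\<dots> \<le> - r * L"
    using neg partial_sum_le[OF opt_in_polytope, of "cols - B"] by (intro mult_left_mono) auto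
  finally show ?thesis .
qed

text \<open>The entering variable jumps from 0 to at least \<open>\<delta>\<close>, and each unit
  saves at least the gap divided by \<open>L\<close>. That second fact is a hypothesis because the
  two rules obtain it differently.\<close>

lemma gap_pivot:
  assumes piv: "simplex_pivot P c B j l B'" and r: "gap (basic_solution P B) \<le> - reduced_cost P c B j * L"
    and moves: "basic_solution P B' j \<noteq> 0"
  shows "gap (basic_solution P B') \<le> (1 - \<delta> / L) * gap (basic_solution P B)"
proof -
  let ?\<theta> = "basic_solution P B' j" and ?r = "reduced_cost P c B j"
  have fB': "feasible_basis P B'" by (rule pivot_feasible[OF piv])
  then have "0 \<le> ?\<theta>" using polytope_nonneg by (simp add: feasible_basis_iff)
  then have th: "\<delta> \<le> ?\<theta>" using moves grain[OF fB', of j] by simp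
  have neg: "?r < 0" using piv by (simp add: simplex_pivot_def)
  have "gap (basic_solution P B') = gap (basic_solution P B) + ?\<theta> * ?r"
    using pivot_objective[OF piv] pivot_entering_value[OF piv] by (simp add: gap_def)
  also have "?\<theta> * ?r \<le> \<delta> * ?r" using th neg by (intro mult_right_mono_neg) auto
  also have "\<delta> * ?r \<le> - (\<delta> / L) * gap (basic_solution P B)"
    using mult_left_mono[OF r, of "\<delta> / L"] delta L_pos by simp
  finally show ?thesis by (simp add: algebra_simps)
qed

lemma pivot_moves_iff:
  assumes piv: "simplex_pivot P c B j l B'"
  shows "basic_solution P B' = basic_solution P B \<longleftrightarrow> basic_solution P B' j = 0"
proof
  assume "basic_solution P B' = basic_solution P B"
  then show "basic_solution P B' j = 0"
    using piv basic_solution_outside[of j B] by (simp add: simplex_pivot_def)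
next
  assume "basic_solution P B' j = 0"
  then have "basic_solution P B l / pivot_column P B j l = 0"
    using pivot_entering_value[OF piv] by simp
  then show "basic_solution P B' = basic_solution P B"
    unfolding pivot_basic_solution[OF piv] by (simp only: mult_zero_left add_0_right)
qed

lemma gap_pivot_less:
  assumes piv: "simplex_pivot P c B j l B'" and moves: "basic_solution P B' \<noteq> basic_solution P B"
  shows "gap (basic_solution P B') < gap (basic_solution P B)"
proof -
  have "basic_solution P B' j \<noteq> 0" using moves pivot_moves_iff[OF piv] by simp
  then have "0 < basic_solution P B' j"
    using pivot_entering_value[OF piv] pivot_length_nonneg[OF piv] by linarith
  moreover have "reduced_cost P c B j < 0" using piv by (simp add: simplex_pivot_def)
  ultimately have "basic_solution P B' j * reduced_cost P c B j < 0" by (rule mult_pos_neg)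
  then show ?thesis
    using pivot_objective[OF piv] unfolding gap_def pivot_entering_value[OF piv] by linarith
qed

lemma dantzig_step_gap:
  assumes step: "dantzig_step P c B B'"
    and moves: "basic_solution P B' \<noteq> basic_solution P B"
  shows "gap (basic_solution P B') \<le> (1 - \<delta> / L) * gap (basic_solution P B)"
proof -
  obtain j l where piv: "simplex_pivot P c B j l B'"
    and min: "\<And>k. k \<in> cols - B \<Longrightarrow> reduced_cost P c B j \<le> reduced_cost P c B k"
    using step unfolding dantzig_step_def by blast
  then have "feasible_basis P B" "reduced_cost P c B j < 0" by (auto simp: simplex_pivot_def)
  then show ?thesis
    using gap_pivot[OF piv gap_le_reduced_cost] min pivot_moves_iff[OF piv] moves by simp
qed

text \<open>Outside the support of the current point, an improving direction towards the optimum is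
  nonnegative. One of minimal support there, normalized to sum 1, is an edge direction.\<close>

lemma improving_pivot_exists:
  assumes fB: "feasible_basis P B" and pos: "0 < gap (basic_solution P B)"
  obtains C j l D where "basic_solution P C = basic_solution P B" "simplex_pivot P c C j l D"
    "basic_solution P D j \<noteq> 0" "gap (basic_solution P C) \<le> - reduced_cost P c C j * L"
proof -
  let ?x = "basic_solution P B" and ?y = "basic_solution P Bopt"
  have B: "is_basis P B" and x: "?x \<in> polytope_of P" using fB by (auto simp: feasible_basis_iff)
  have sol: "?x \<in> solution_set P" "?y \<in> solution_set P"
    using x opt_in_polytope by (auto simp: polytope_of_def)
  define S where "S = {k. 0 < ?x k}"
  define T where "T = cols - S"
  have SB: "S \<subseteq> B" using basic_solution_outside[of _ B] by (force simp: S_def)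
  have Scols: "S \<subseteq> cols" using SB basis_subset[OF B] by blast
  have finT: "finite T" using finite_cols by (simp add: T_def)
  have xT: "?x k = 0" if "k \<notin> S" for k using that polytope_nonneg[OF x, of k] by (auto simp: S_def)
  \<comment> \<open>A null vector that vanishes on \<open>T\<close> is supported on
    \<open>S\<close>, whose columns belong to \<open>B\<close> and are independent. Directions are
    therefore determined by their coordinates in \<open>T\<close>.\<close>
  have in_S: "d k = 0" if "null_vector P d" "\<And>k. k \<in> T \<Longrightarrow> d k = 0" for d k
  proof (rule independent_columns_null_vector[of B d])
    fix j assume "j \<notin> B"
    then show "d j = 0" using that SB by (cases "j \<in> cols") (auto simp: T_def null_vector_def)
  qed (use B that in \<open>auto simp: is_basis_iff\<close>)
  define u where "u k = ?y k - ?x k" for k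
  have u: "null_vector P u"
    using sol by (auto simp: null_vector_def solution_set_def u_def right_diff_distrib sum_subtractf)
  have uT: "0 \<le> u k" "u k = ?y k" if "k \<in> T" for k
    using that xT[of k] polytope_nonneg[OF opt_in_polytope, of k] by (auto simp: u_def T_def)
  define \<sigma> where "\<sigma> = (\<Sum>k\<in>T. u k)"
  have "\<sigma> \<noteq> 0"
  proof
    assume "\<sigma> = 0"
    then have "\<forall>k\<in>T. u k = 0" using uT finT by (simp add: \<sigma>_def sum_nonneg_eq_0_iff)
    then have "?y = ?x" using in_S[OF u] by (auto simp: u_def fun_eq_iff)
    then show False using pos by (simp add: gap_def)
  qed
  moreover have "0 \<le> \<sigma>" using uT by (auto simp: \<sigma>_def intro: sum_nonneg)
  ultimately have sp: "0 < \<sigma>" by simp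
  have sL: "\<sigma> \<le> L"
    using partial_sum_le[OF opt_in_polytope, of T] uT by (simp add: \<sigma>_def T_def)
  \<comment> \<open>The last condition asks for a saving of at least \<open>gap ?x / L\<close> per
    unit of mass on \<open>T\<close>. The direction \<open>u\<close> to the optimum meets it after
    division by its mass \<open>\<sigma>\<close>, because \<open>\<sigma> \<le> L\<close>.\<close>
  define F where "F d \<longleftrightarrow> null_vector P d \<and> (\<forall>k\<in>T. 0 \<le> d k) \<and> (\<Sum>k\<in>T. d k) = 1 \<and>
      gap ?x \<le> - objective P c d * L" for d
  have "F (\<lambda>k. u k / \<sigma>)"
  proof -
    have "objective P c (\<lambda>k. u k / \<sigma>) = - gap ?x / \<sigma>"
      by (simp add: objective_def u_def gap_def right_diff_distrib sum_subtractf
          flip: sum_divide_distrib diff_divide_distrib)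
    moreover have "gap ?x \<le> gap ?x * L / \<sigma>" using sL pos sp by (simp add: pos_le_divide_eq)
    ultimately have "gap ?x \<le> - objective P c (\<lambda>k. u k / \<sigma>) * L" by simp
    moreover have "null_vector P (\<lambda>k. u k / \<sigma>)"
      using u by (simp add: null_vector_def flip: sum_divide_distrib)
    moreover have "(\<Sum>k\<in>T. u k / \<sigma>) = 1" using sp by (simp add: \<sigma>_def flip: sum_divide_distrib)
    ultimately show ?thesis using uT sp by (simp add: F_def)
  qed
  then obtain d where d: "F d" and least: "\<And>e. F e \<Longrightarrow> card {k\<in>T. d k \<noteq> 0} \<le> card {k\<in>T. e k \<noteq> 0}"
    using ex_has_least_nat[of F _ "\<lambda>d. card {k\<in>T. d k \<noteq> 0}"] by blast
  have nd: "null_vector P d" and dT: "\<And>k. k \<in> T \<Longrightarrow> 0 \<le> d k" and dsum: "(\<Sum>k\<in>T. d k) = 1"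
    and dgap: "gap ?x \<le> - objective P c d * L" using d by (auto simp: F_def)
  define W where "W = {k\<in>T. d k \<noteq> 0}"
  have "\<exists>k\<in>T. d k \<noteq> 0" using dsum by (metis sum.neutral zero_neq_one)
  then obtain j where j: "j \<in> W" by (auto simp: W_def)
  then have jT: "j \<in> T" "0 < d j" using dT[of j] by (auto simp: W_def)
  have SW: "S \<union> W \<subseteq> cols" using Scols by (auto simp: W_def T_def)
  have d0: "d k = 0" if "k \<notin> S \<union> W" for k
    using that nd by (cases "k \<in> cols") (auto simp: W_def T_def null_vector_def)
  have "independent_columns P (S \<union> W - {j})"
  proof (rule independent_columnsI)
    fix z k
    assume z: "null_vector P z" "\<And>k. k \<notin> S \<union> W - {j} \<Longrightarrow> z k = 0"
    show "z k = 0"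
    proof (rule ccontr)
      assume "z k \<noteq> 0"
      \<comment> \<open>Subtracting \<open>a\<close> times \<open>d\<close> from the dependence
        \<open>z\<close> makes the mass on \<open>T\<close> zero, and the sign is chosen so that the
        cost does not rise. Moving from \<open>d\<close> along \<open>e\<close> until a coordinate
        in \<open>T\<close> reaches 0 gives an element of \<open>F\<close> with smaller
        support.\<close>
      define a where "a = (\<Sum>k\<in>T. z k)"
      define e0 where "e0 k = z k - a * d k" for k
      define e where "e = (if objective P c e0 \<le> 0 then e0 else (\<lambda>k. - e0 k))"
      have "null_vector P e0"
        using z(1) nd by (simp add: null_vector_def e0_def right_diff_distrib sum_subtractf
            mult.left_commute[of _ a] flip: sum_distrib_left)
      then have ne: "null_vector P e" by (simp add: e_def null_vector_def sum_negf)
      have "(\<Sum>k\<in>T. e0 k) = 0"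
        by (simp add: e0_def sum_subtractf a_def dsum flip: sum_distrib_left)
      then have esum: "(\<Sum>k\<in>T. e k) = 0" by (simp add: e_def sum_negf)
      have eobj: "objective P c e \<le> 0" by (auto simp: e_def objective_def sum_negf)
      have e0W: "e k = 0" if "k \<notin> S \<union> W" for k
        using z(2)[of k] d0[of k] that by (simp add: e_def e0_def)
      have "\<exists>k\<in>T. e k \<noteq> 0"
      proof (rule ccontr)
        assume "\<not> ?thesis"
        then have "e i = 0" for i using in_S[OF ne] by blast
        then have e00: "z i = a * d i" for i by (metis diff_eq_diff_eq e0_def e_def neg_equal_0_iff_equal right_minus_eq)
        have "z j = 0" using z(2) by simp
        then have "a = 0" using e00[of j] jT by simp
        then show False using e00[of k] \<open>z k \<noteq> 0\<close> by simp
      qed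
      then have "\<exists>k\<in>T. e k < 0"
        using esum finT sum_nonneg_eq_0_iff[of T e] by (meson not_less)
      then obtain k1 where k1: "k1 \<in> T" "e k1 < 0" by blast
      define N where "N = {k\<in>T. e k < 0}"
      obtain k0 where k0: "k0 \<in> N" "\<And>k. k \<in> N \<Longrightarrow> d k0 / - e k0 \<le> d k / - e k"
        using minimizer_exists[of N "\<lambda>k. d k / - e k"] k1 finT by (auto simp: N_def)
      have k0': "k0 \<in> T" "e k0 < 0" using k0 by (auto simp: N_def)
      define t where "t = d k0 / - e k0"
      have t: "0 \<le> t" using k0' dT[of k0] by (simp add: t_def divide_nonneg_neg)
      have "F (\<lambda>k. d k + t * e k)"
        unfolding F_def
      proof (intro conjI ballI)
        show "null_vector P (\<lambda>k. d k + t * e k)"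
          using nd ne by (simp add: null_vector_def distrib_left sum.distrib
              mult.left_commute[of _ t] flip: sum_distrib_left)
        show "(\<Sum>k\<in>T. d k + t * e k) = 1"
          using dsum esum by (simp add: sum.distrib flip: sum_distrib_left)
        have "objective P c (\<lambda>k. d k + t * e k) = objective P c d + t * objective P c e"
          by (simp add: objective_def distrib_left sum.distrib sum_distrib_left mult.left_commute)
        then have "objective P c (\<lambda>k. d k + t * e k) \<le> objective P c d"
          using mult_nonneg_nonpos[OF t eobj] by simp
        then have "- objective P c d * L \<le> - objective P c (\<lambda>k. d k + t * e k) * L"
          using L_pos by simp
        with dgap show "gap ?x \<le> - objective P c (\<lambda>k. d k + t * e k) * L" by (rule order_trans)
      next
        fix k assume k: "k \<in> T"
        show "0 \<le> d k + t * e k"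
        proof (cases "e k < 0")
          case True
          then have "t \<le> d k / - e k" using k0(2)[of k] k by (simp add: t_def N_def)
          then have "t * - e k \<le> d k" using True pos_le_divide_eq[of "- e k" t "d k"] by simp
          then show ?thesis by simp
        next
          case False
          then show ?thesis using dT[OF k] t by simp
        qed
      qed
      from least[OF this] have "card W \<le> card {k\<in>T. d k + t * e k \<noteq> 0}" by (simp add: W_def)
      moreover have "{k\<in>T. d k + t * e k \<noteq> 0} \<subseteq> W - {k0}"
      proof
        fix k assume k: "k \<in> {k\<in>T. d k + t * e k \<noteq> 0}"
        have "k \<in> W"
        proof (rule ccontr)
          assume "k \<notin> W"
          then have "d k = 0" "e k = 0" using k e0W[of k] by (auto simp: W_def T_def)
          then show False using k by simp
        qed
        moreover have "d k0 + t * e k0 = 0" using k0' by (simp add: t_def)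
        ultimately show "k \<in> W - {k0}" using k by auto
      qed
      moreover have "k0 \<in> W" using e0W[of k0] k0' by (auto simp: T_def)
      moreover have "finite W" using finT by (simp add: W_def)
      ultimately show False
        using card_mono[of "W - {k0}" "{k\<in>T. d k + t * e k \<noteq> 0}"] card_Diff1_less[of W k0] by simp
    qed
  qed (use SW in blast)
  then obtain C where C: "is_basis P C" "S \<union> W - {j} \<subseteq> C"
    using extend_to_basis[OF rank, of "S \<union> W - {j}"] SW by blast
  have bsC: "basic_solution P C = ?x"
    using C jT xT by (intro basic_solution_unique[OF C(1) sol(1), symmetric]) (auto simp: T_def)
  then have fC: "feasible_basis P C" using C(1) x by (simp add: feasible_basis_iff)
  have jC: "j \<in> cols - C"
  proof -
    \<comment> \<open>Otherwise \<open>d\<close> would be a nontrivial dependence among the columns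
      of a basis.\<close>
    have "j \<notin> C"
    proof
      assume "j \<in> C"
      then have "S \<union> W \<subseteq> C" using C(2) by blast
      then have supp: "d i = 0" if "i \<notin> C" for i using that by (intro d0) blast
      have "independent_columns P C" using C(1) by (simp only: is_basis_iff)
      from independent_columns_null_vector[OF basis_subset[OF C(1)] this nd supp]
      show False using jT(2) by (metis less_irrefl)
    qed
    then show ?thesis using jT by (simp add: T_def)
  qed
  \<comment> \<open>The only nonbasic coordinate of \<open>d\<close> is \<open>j\<close>, so
    \<open>d\<close> is \<open>d j\<close> times the pivot direction of \<open>C\<close>; as
    \<open>d j \<le> 1\<close>, the reduced cost is at least as negative as the cost of
    \<open>d\<close>.\<close>
  have dC: "d k = 0" if "k \<in> cols - C - {j}" for k using that C(2) d0[of k] by auto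
  have "objective P c d = reduced_cost P c C j * d j"
    unfolding null_vector_cost[OF C(1) nd]
    using jC finite_cols dC by (subst sum.remove[of _ j]) (auto intro!: sum.neutral)
  moreover have "d j \<le> 1" using member_le_sum[of j T d] jT dT finT dsum by simp
  moreover have "objective P c d < 0"
    using dgap pos L_pos by (metis less_le_trans minus_less_iff mult_less_cancel_right2 neg_0_less_iff_less not_less_iff_gr_or_eq zero_less_mult_pos2 mult_minus_left)
  ultimately have neg: "reduced_cost P c C j < 0" and "reduced_cost P c C j \<le> objective P c d"
    using jT(2) mult_left_mono_neg[of "d j" 1 "reduced_cost P c C j"]
    by (auto simp: mult_less_0_iff)
  then have "- objective P c d * L \<le> - reduced_cost P c C j * L"
    using L_pos by simp
  with dgap have gC: "gap (basic_solution P C) \<le> - reduced_cost P c C j * L"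
    by (simp add: bsC)
  obtain l D where piv: "simplex_pivot P c C j l D"
    using pivot_exists[OF fC jC neg] no_ray[OF x] by metis
  then have l: "l \<in> C" "0 < pivot_column P C j l" by (auto simp: simplex_pivot_def)
  \<comment> \<open>The leaving variable decreases along \<open>d\<close>, which no coordinate in
    \<open>T\<close> does. It is thus positive at the current point, and the pivot is not
    degenerate.\<close>
  have "d l = - (d j * pivot_column P C j l)"
    unfolding null_vector_dictionary[OF C(1) nd l(1)]
    using jC finite_cols dC by (subst sum.remove[of _ j]) (auto intro!: sum.neutral)
  then have "d l < 0" using jT l by simp
  then have "l \<in> S" using dT[of l] l(1) basis_subset[OF C(1)] by (auto simp: T_def)
  then have "basic_solution P D j \<noteq> 0"
    using pivot_entering_value[OF piv] l(2) by (simp add: bsC S_def)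
  from that[OF bsC piv this gC] show ?thesis .
qed

text \<open>The chosen pivot gains at least as much as the good pivot exhibited at the same point,
  possibly from another basis. A gap to apply this to exists because the step moves the
  point.\<close>

lemma greatest_improvement_step_gap:
  assumes step: "greatest_improvement_step P c B B'" and fB: "feasible_basis P B"
    and moves: "basic_solution P B' \<noteq> basic_solution P B"
  shows "gap (basic_solution P B') \<le> (1 - \<delta> / L) * gap (basic_solution P B)"
proof -
  obtain C j l where C: "basic_solution P C = basic_solution P B" "simplex_pivot P c C j l B'"
    and best: "\<And>D. bfs_pivot P c B D \<Longrightarrow> decrease P c B D \<le> decrease P c B B'"
    using step unfolding greatest_improvement_step_def bfs_pivot_def by blast
  have "gap (basic_solution P B') < gap (basic_solution P B)"
    using gap_pivot_less[OF C(2)] moves C(1) by simp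
  moreover have "0 \<le> gap (basic_solution P B')"
    using pivot_feasible[OF C(2)] by (simp add: feasible_basis_iff gap_nonneg)
  ultimately have "0 < gap (basic_solution P B)" by linarith
  from improving_pivot_exists[OF fB this]
  obtain C' j' l' D where D: "basic_solution P C' = basic_solution P B" "simplex_pivot P c C' j' l' D"
    "basic_solution P D j' \<noteq> 0" "gap (basic_solution P C') \<le> - reduced_cost P c C' j' * L" by blast
  then have "gap (basic_solution P D) \<le> (1 - \<delta> / L) * gap (basic_solution P B)"
    using gap_pivot[OF D(2,4,3)] by simp
  moreover have "decrease P c B D \<le> decrease P c B B'"
    using D(1,2) by (intro best) (auto simp: bfs_pivot_def)
  ultimately show ?thesis by (simp add: decrease_def gap_def)
qed

lemma pivot_step_gap:
  assumes step: "pivot_step rule P c B B'" and fB: "feasible_basis P B"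
  shows "feasible_basis P B'"
    and "basic_solution P B' \<noteq> basic_solution P B \<Longrightarrow>
      gap (basic_solution P B') < gap (basic_solution P B) \<and>
      gap (basic_solution P B') \<le> (1 - \<delta> / L) * gap (basic_solution P B)"
proof -
  obtain C j l where C: "basic_solution P C = basic_solution P B" "simplex_pivot P c C j l B'"
    using step by (cases rule) (auto simp: dantzig_step_def greatest_improvement_step_def bfs_pivot_def)
  show "feasible_basis P B'" by (rule pivot_feasible[OF C(2)])
  assume moves: "basic_solution P B' \<noteq> basic_solution P B"
  show "gap (basic_solution P B') < gap (basic_solution P B) \<and>
      gap (basic_solution P B') \<le> (1 - \<delta> / L) * gap (basic_solution P B)"
    using gap_pivot_less[OF C(2)] dantzig_step_gap[of B B'] greatest_improvement_step_gap[of B B']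
      step fB moves C(1) by (cases rule) auto
qed

end

section \<open>Counting visited vertices\<close>

text \<open>For the charging argument: \<open>f\<close> charges each vertex index to a variable, and
  indices charged to the same variable lie in a window of length \<open>K\<close>.\<close>

lemma card_le_mult_card_of_short_fibres:
  fixes I :: "nat set"
  assumes fin: "finite I" "finite J" and f: "f ` I \<subseteq> J"
    and short: "\<And>i k. i \<in> I \<Longrightarrow> k \<in> I \<Longrightarrow> f i = f k \<Longrightarrow> k < i + K"
  shows "card I \<le> card J * K"
proof -
  have fibre: "card {i\<in>I. f i = j} \<le> K" for j
  proof (cases "{i\<in>I. f i = j} = {}")
    case False
    define m where "m = Min {i\<in>I. f i = j}"
    have "m \<in> {i\<in>I. f i = j}" unfolding m_def using fin False by (intro Min_in) auto
    moreover have "m \<le> k" if "k \<in> I" "f k = j" for k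
      unfolding m_def using fin that by (intro Min_le) auto
    ultimately have "{i\<in>I. f i = j} \<subseteq> {m..<m + K}" using short[of m] by auto
    from card_mono[OF _ this] show ?thesis by simp
  qed (simp only: card.empty le0)
  have "I = (\<Union>j\<in>J. {i\<in>I. f i = j})" using f by auto
  then have "card I \<le> (\<Sum>j\<in>J. card {i\<in>I. f i = j})" using card_UN_le[OF fin(2)] by metis
  also have "\<dots> \<le> card J * K" using sum_bounded_above[of J, OF fibre] by simp
  finally show ?thesis .
qed

context lp_with_optimal_basis
begin

text \<open>The criterion of Kitahara and Mizuno: a variable that is positive at \<open>x\<close> and carries the
  average share of the gap vanishes at every vertex whose gap is smaller by the factor \<open>\<delta> / L\<close>.\<close>

lemma vanishing_variable:
  assumes x: "x \<in> polytope_of P" and pos: "0 < gap x"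
  obtains j where "j \<in> cols - Bopt" "0 < x j"
    "\<And>B. feasible_basis P B \<Longrightarrow> gap (basic_solution P B) < \<delta> / L * gap x \<Longrightarrow> basic_solution P B j = 0"
proof -
  let ?s = "reduced_cost P c Bopt"
  have "\<exists>j\<in>cols - Bopt. 0 < x j \<and> gap x \<le> ?s j * L"
  proof (rule ccontr)
    assume *: "\<not> ?thesis"
    have le: "?s j * L * x j \<le> gap x * x j" if "j \<in> cols - Bopt" for j
    proof (cases "x j = 0")
      case False
      then have "0 < x j" using polytope_nonneg[OF x, of j] by simp
      then have "?s j * L \<le> gap x" using * that by (meson linear)
      with \<open>0 < x j\<close> show ?thesis by (intro mult_right_mono) auto
    qed simp
    have "\<exists>j\<in>cols - Bopt. x j \<noteq> 0"
    proof (rule ccontr)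
      assume "\<not> ?thesis"
      then have "gap x = 0" unfolding gap_eq[OF x] by (intro sum.neutral) auto
      with pos show False by simp
    qed
    then obtain j where j: "j \<in> cols - Bopt" "0 < x j"
      using polytope_nonneg[OF x] by (auto simp: less_le)
    \<comment> \<open>The weights \<open>x j\<close> sum to at most \<open>L\<close>; if all
      positive coordinates had a small reduced cost, their weighted sum would fall short of the
      gap.\<close>
    have "gap x * L = (\<Sum>j\<in>cols - Bopt. ?s j * L * x j)"
      unfolding gap_eq[OF x] by (simp add: sum_distrib_left sum_distrib_right ac_simps)
    also have "\<dots> < (\<Sum>j\<in>cols - Bopt. gap x * x j)"
    proof (rule sum_strict_mono_ex1)
      show "\<exists>j\<in>cols - Bopt. ?s j * L * x j < gap x * x j" using * j by (auto intro!: bexI[of _ j])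
    qed (use finite_cols le in auto)
    also have "\<dots> = gap x * (\<Sum>j\<in>cols - Bopt. x j)" by (simp add: sum_distrib_left)
    also have "\<dots> \<le> gap x * L"
      using pos partial_sum_le[OF x, of "cols - Bopt"] by (intro mult_left_mono) auto
    finally show False by simp
  qed
  then obtain j where j: "j \<in> cols - Bopt" "0 < x j" "gap x \<le> ?s j * L" by blast
  show ?thesis
  proof (rule that[OF j(1,2)])
    fix B assume fB: "feasible_basis P B" and less: "gap (basic_solution P B) < \<delta> / L * gap x"
    have xB: "basic_solution P B \<in> polytope_of P" using fB by (simp add: feasible_basis_iff)
    have "0 < ?s j * L" using j(3) pos by linarith
    then have s: "0 < ?s j" using L_pos by (simp add: zero_less_mult_iff)
    have "?s j * basic_solution P B j \<le> gap (basic_solution P B)"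
      by (rule reduced_cost_le_gap[OF xB j(1)])
    also have "\<dots> < \<delta> / L * gap x" by (rule less)
    also have "\<dots> \<le> \<delta> / L * (?s j * L)" using delta L_pos by (intro mult_left_mono j(3)) auto
    also have "\<dots> = ?s j * \<delta>" using L_pos by simp
    finally have "basic_solution P B j < \<delta>" using s by simp
    then show "basic_solution P B j = 0"
      using grain[OF fB, of j] polytope_nonneg[OF xB, of j] by force
  qed
qed

lemma path_feasible:
  assumes "successively (pivot_step rule P c) Bs" "feasible_basis P (hd Bs)" "B \<in> set Bs"
  shows "feasible_basis P B"
  using assms
proof (induction Bs rule: induct_list012)
  case (3 A A' Bs)
  have s: "pivot_step rule P c A A'" "successively (pivot_step rule P c) (A' # Bs)" "feasible_basis P A"
    using 3(3,4) by (simp_all only: successively.simps list.sel)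
  have "feasible_basis P A'" by (rule pivot_step_gap(1)[OF s(1,3)])
  then have "feasible_basis P B" if "B \<in> set (A' # Bs)"
    using 3(2) s(2) that by (simp only: list.sel simp_thms)
  with 3(5) s(3) show ?case by (metis set_ConsD)
qed simp_all

lemma card_visited_le:
  assumes path: "simplex_path rule P c Bs" and K: "(1 - \<delta> / L) ^ K < \<delta> / L"
  shows "card (visited_vertices P Bs) \<le> (card cols - card rows) * K + 1"
proof -
  have "feasible_basis P (hd Bs)" "successively (pivot_step rule P c) Bs"
    using path by (auto simp: simplex_path_def)
  then have feas: "feasible_basis P B" if "B \<in> set Bs" for B
    using path_feasible that by blast
  define q where "q = 1 - \<delta> / L"
  have q: "0 \<le> q" using delta L_pos by (simp add: q_def)
  define R where "R x y \<longleftrightarrow> gap y < gap x \<and> gap y \<le> q * gap x" for x y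
  \<comment> \<open>Degenerate pivots repeat the point. Once the repetitions are merged, every step
    contracts the gap.\<close>
  define ys where "ys = remdups_adj (map (basic_solution P) Bs)"
  have visited: "visited_vertices P Bs = set ys" by (simp add: visited_vertices_def ys_def)
  have ysB: "\<exists>B. feasible_basis P B \<and> y = basic_solution P B" if "y \<in> set ys" for y
    using that feas by (auto simp: ys_def)
  have "successively (\<lambda>x y. y \<noteq> x \<longrightarrow> R x y) (map (basic_solution P) Bs)"
    unfolding successively_map
  proof (rule successively_mono)
    show "successively (pivot_step rule P c) Bs" using path by (simp add: simplex_path_def)
    fix A B assume "A \<in> set Bs" "pivot_step rule P c A B"
    then show "basic_solution P B \<noteq> basic_solution P A \<longrightarrow> R (basic_solution P A) (basic_solution P B)"
      using feas pivot_step_gap(2)[of rule A B] by (simp add: R_def q_def)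
  qed
  then have "successively (\<lambda>x y. y \<noteq> x \<longrightarrow> R x y) ys"
    unfolding ys_def by (rule successively_remdups_adjI)
  moreover have "successively (\<noteq>) ys"
    using distinct_adj_remdups_adj by (simp add: ys_def distinct_adj_def)
  ultimately have stepR: "R (ys ! i) (ys ! Suc i)" if "Suc i < length ys" for i
    using that by (fastforce simp: successively_conv_nth)
  have in_polytope: "ys ! i \<in> polytope_of P" if "i < length ys" for i
    using ysB[of "ys ! i"] that by (auto simp: feasible_basis_iff)
  have decay: "gap (ys ! (i + k)) \<le> q ^ k * gap (ys ! i)" if "i + k < length ys" for i k
    using that
  proof (induction k)
    case (Suc k)
    have "gap (ys ! (i + Suc k)) \<le> q * gap (ys ! (i + k))"
      using stepR[of "i + k"] Suc.prems by (simp add: R_def)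
    also have "\<dots> \<le> q * (q ^ k * gap (ys ! i))"
      using Suc q by (intro mult_left_mono) auto
    finally show ?case by (simp add: mult.assoc)
  qed simp
  define I where "I = {i. i < length ys \<and> 0 < gap (ys ! i)}"
  have "\<exists>j. j \<in> cols - Bopt \<and> 0 < (ys ! i) j \<and> (\<forall>B. feasible_basis P B \<longrightarrow>
      gap (basic_solution P B) < \<delta> / L * gap (ys ! i) \<longrightarrow> basic_solution P B j = 0)" if "i \<in> I" for i
    using vanishing_variable[of "ys ! i"] that in_polytope[of i] unfolding I_def by blast
  then obtain f where f: "\<And>i. i \<in> I \<Longrightarrow> f i \<in> cols - Bopt" "\<And>i. i \<in> I \<Longrightarrow> 0 < (ys ! i) (f i)"
    "\<And>i B. i \<in> I \<Longrightarrow> feasible_basis P B \<Longrightarrow> gap (basic_solution P B) < \<delta> / L * gap (ys ! i)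
      \<Longrightarrow> basic_solution P B (f i) = 0" by metis
  have "card I \<le> card (cols - Bopt) * K"
  proof (rule card_le_mult_card_of_short_fibres)
    fix i k assume ik: "i \<in> I" "k \<in> I" "f i = f k"
    show "k < i + K"
    proof (rule ccontr)
      assume "\<not> k < i + K"
      then obtain m where m: "k = i + (K + m)" by (metis add.assoc le_Suc_ex not_less)
      have pos: "0 < gap (ys ! i)" using ik by (simp add: I_def)
      \<comment> \<open>After \<open>K\<close> or more steps the gap is below the threshold for
        \<open>f i\<close>, so that variable vanishes at \<open>ys ! k\<close>; yet it equals
        \<open>f k\<close>, which is positive there.\<close>
      have "gap (ys ! k) \<le> q ^ (K + m) * gap (ys ! i)" using decay[of i "K + m"] ik m by (simp add: I_def)
      also have "\<dots> \<le> q ^ K * gap (ys ! i)"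
        using q pos delta L_pos by (intro mult_right_mono power_decreasing) (auto simp: q_def)
      also have "\<dots> < \<delta> / L * gap (ys ! i)" using K pos by (intro mult_strict_right_mono) (auto simp: q_def)
      finally have less: "gap (ys ! k) < \<delta> / L * gap (ys ! i)" .
      obtain B where "feasible_basis P B" "ys ! k = basic_solution P B"
        using ysB[of "ys ! k"] ik(2) by (auto simp: I_def)
      then have "(ys ! k) (f i) = 0" using f(3)[OF ik(1), of B] less by simp
      then show False using f(2)[OF ik(2)] ik(3) by simp
    qed
  qed (use f finite_cols in \<open>auto simp: I_def\<close>)
  also have "card (cols - Bopt) = card cols - card rows"
    using basis_opt finite_basis by (simp add: is_basis_iff card_Diff_subset)
  finally have cardI: "card I \<le> (card cols - card rows) * K" .
  \<comment> \<open>Gaps are nonnegative and strictly decreasing, so only the last point can have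
    gap 0; this is the additional 1.\<close>
  have "{..<length ys} \<subseteq> insert (length ys - 1) I"
  proof
    fix i assume i: "i \<in> {..<length ys}"
    show "i \<in> insert (length ys - 1) I"
    proof (cases "Suc i < length ys")
      case True
      then have "gap (ys ! Suc i) < gap (ys ! i)" using stepR[of i] by (simp add: R_def)
      moreover have "0 \<le> gap (ys ! Suc i)" using True in_polytope by (intro gap_nonneg) simp
      ultimately show ?thesis using i by (simp add: I_def)
    qed (use i in auto)
  qed
  then have "length ys \<le> card (insert (length ys - 1) I)"
    using card_mono[of "insert (length ys - 1) I" "{..<length ys}"] by (simp add: I_def)
  also have "\<dots> \<le> Suc (card I)" by (rule card_insert_le_m1) simp_all
  finally show ?thesis using cardI card_length[of ys] visited by simp
qed

end

lemma (in bounded_lp) card_visited_vertices_le: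
  assumes path: "simplex_path rule P c Bs" and K: "(1 - \<delta> / L) ^ K < \<delta> / L"
  shows "card (visited_vertices P Bs) \<le> (card cols - card rows) * K + 1"
proof -
  have f: "feasible_basis P (hd Bs)" using path by (simp add: simplex_path_def)
  then have "basic_solution P (hd Bs) \<in> polytope_of P" by (simp add: feasible_basis_iff)
  then obtain B where "feasible_basis P B" "\<And>j. j \<in> cols - B \<Longrightarrow> 0 \<le> reduced_cost P c B j"
    using optimal_basis_exists[OF f, of c] no_ray by blast
  then interpret lp_with_optimal_basis P L \<delta> c B by unfold_locales
  show ?thesis by (rule card_visited_le[OF path K])
qed

section \<open>Supports of doubly stochastic matrices\<close>

text \<open>The argument of Halmos and Vaughan: if every proper nonempty subset has a surplus of
  neighbours, any single assignment may be fixed; otherwise a tight subset \<open>J\<close> with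
  neighbours \<open>U\<close> splits the problem into \<open>J\<close> and the rest, which avoids
  \<open>U\<close>.\<close>

lemma hall_marriage:
  assumes "finite I" "\<And>i. i \<in> I \<Longrightarrow> finite (A i)" "\<And>J. J \<subseteq> I \<Longrightarrow> card J \<le> card (\<Union>(A ` J))"
  shows "\<exists>f. inj_on f I \<and> (\<forall>i\<in>I. f i \<in> A i)"
  using assms
proof (induction "card I" arbitrary: I A rule: less_induct)
  case less
  note fin = less.prems(1,2) and hall = less.prems(3)
  have fin_U: "finite (\<Union>(A ` J))" if "J \<subseteq> I" for J
    using that fin finite_subset[of J I] by auto
  consider "I = {}"
    | "I \<noteq> {}" "\<And>J. J \<subset> I \<Longrightarrow> J \<noteq> {} \<Longrightarrow> card J < card (\<Union>(A ` J))"
    | J where "J \<subset> I" "J \<noteq> {}" "card (\<Union>(A ` J)) \<le> card J"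
    using not_less by blast
  then show ?case
  proof cases
    case 1
    then show ?thesis by simp
  next
    case 2
    then obtain i where i: "i \<in> I" by blast
    have "A i \<noteq> {}" using hall[of "{i}"] i by auto
    then obtain a where a: "a \<in> A i" by blast
    have "\<exists>f. inj_on f (I - {i}) \<and> (\<forall>k\<in>I - {i}. f k \<in> A k - {a})"
    proof (rule less.hyps)
      show "card (I - {i}) < card I" using card_Diff1_less[OF fin(1) i] .
      fix J assume J: "J \<subseteq> I - {i}"
      have "card J \<le> card (\<Union>(A ` J)) - 1"
      proof (cases "J = {}")
        case False
        then have "card J < card (\<Union>(A ` J))" using J i by (intro 2(2)) auto
        then show ?thesis by simp
      qed simp
      also have "\<dots> \<le> card (\<Union>(A ` J) - {a})" by (simp add: card_Diff_singleton_if)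
      also have "\<Union>(A ` J) - {a} = (\<Union>k\<in>J. A k - {a})" by blast
      finally show "card J \<le> card (\<Union>k\<in>J. A k - {a})" .
    qed (use fin in auto)
    then obtain f where f: "inj_on f (I - {i})" "\<forall>k\<in>I - {i}. f k \<in> A k - {a}" by blast
    have "inj_on (f(i := a)) (insert i (I - {i}))"
      using f by (subst inj_on_insert) (auto simp: inj_on_def)
    then show ?thesis using f(2) a i by (intro exI[of _ "f(i := a)"]) (auto simp: insert_absorb)
  next
    case (3 J)
    define U where "U = \<Union>(A ` J)"
    have JI: "J \<subseteq> I" and finJ: "finite J" using 3 fin finite_subset by auto
    have cU: "card U = card J" using 3(3) hall[OF JI] by (simp add: U_def)
    have "\<exists>f. inj_on f J \<and> (\<forall>k\<in>J. f k \<in> A k)"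
      using fin JI hall finJ psubset_card_mono[OF fin(1) 3(1)] by (intro less.hyps) auto
    then obtain f where f: "inj_on f J" "\<forall>k\<in>J. f k \<in> A k" by blast
    have "\<exists>g. inj_on g (I - J) \<and> (\<forall>k\<in>I - J. g k \<in> A k - U)"
    proof (rule less.hyps)
      show "card (I - J) < card I" using 3 fin by (intro psubset_card_mono) auto
      fix H assume H: "H \<subseteq> I - J"
      have "finite H" using H fin finite_subset[of H I] by blast
      \<comment> \<open>Hall's condition for \<open>H\<close> outside \<open>U\<close> follows from
        that for the union with \<open>J\<close>, since \<open>U\<close> has exactly as many
        elements as \<open>J\<close>.\<close>
      then have "card H + card J = card (H \<union> J)"
        using H finJ by (intro card_Un_disjoint[symmetric]) auto
      also have "\<dots> \<le> card (\<Union>(A ` (H \<union> J)))" using H JI by (intro hall) auto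
      also have "\<dots> = card ((\<Union>k\<in>H. A k - U) \<union> U)" by (rule arg_cong[of _ _ card]) (auto simp: U_def)
      also have "\<dots> \<le> card (\<Union>k\<in>H. A k - U) + card U" by (rule card_Un_le)
      finally show "card H \<le> card (\<Union>k\<in>H. A k - U)" using cU by simp
    qed (use fin in auto)
    then obtain g where g: "inj_on g (I - J)" "\<forall>k\<in>I - J. g k \<in> A k - U" by blast
    define h where "h k = (if k \<in> J then f k else g k)" for k
    have "inj_on h I"
    proof (rule inj_onI)
      fix k l assume kl: "k \<in> I" "l \<in> I" "h k = h l"
      have U: "h i \<in> U \<longleftrightarrow> i \<in> J" if "i \<in> I" for i
        using f(2) g(2) that by (auto simp: h_def U_def)
      show "k = l" using U[of k] U[of l] kl f(1) g(1) by (auto simp: h_def inj_on_def)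
    qed
    then show ?thesis using f(2) g(2) by (intro exI[of _ h]) (auto simp: h_def)
  qed
qed

text \<open>Hall's condition is a mass count: the rows in \<open>J\<close> carry mass
  \<open>card J\<close>, all of it in the columns \<open>N\<close>, each of which holds at most
  1.\<close>

lemma doubly_stochastic_support:
  fixes y :: "'a \<Rightarrow> 'b \<Rightarrow> real"
  assumes fin: "finite R" "finite C" and nonneg: "\<And>r c. r \<in> R \<Longrightarrow> c \<in> C \<Longrightarrow> 0 \<le> y r c"
    and rows: "\<And>r. r \<in> R \<Longrightarrow> (\<Sum>c\<in>C. y r c) = 1" and cols: "\<And>c. c \<in> C \<Longrightarrow> (\<Sum>r\<in>R. y r c) = 1"
  obtains \<sigma> where "bij_betw \<sigma> R C" "\<And>r. r \<in> R \<Longrightarrow> 0 < y r (\<sigma> r)"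
proof -
  define A where "A r = {c\<in>C. 0 < y r c}" for r
  have "real (card R) = (\<Sum>r\<in>R. \<Sum>c\<in>C. y r c)" using rows by simp
  also have "\<dots> = (\<Sum>c\<in>C. \<Sum>r\<in>R. y r c)" by (rule sum.swap)
  also have "\<dots> = real (card C)" using cols by simp
  finally have card: "card R = card C" by simp
  have "\<exists>\<sigma>. inj_on \<sigma> R \<and> (\<forall>r\<in>R. \<sigma> r \<in> A r)"
  proof (rule hall_marriage)
    fix J assume J: "J \<subseteq> R"
    define N where "N = \<Union>(A ` J)"
    have N: "N \<subseteq> C" by (auto simp: N_def A_def)
    have "real (card J) = (\<Sum>r\<in>J. \<Sum>c\<in>C. y r c)" using rows J by (simp add: subset_iff)
    also have "\<dots> = (\<Sum>r\<in>J. \<Sum>c\<in>N. y r c)"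
    proof (rule sum.cong[OF refl])
      fix r assume "r \<in> J"
      then have "y r c = 0" if "c \<in> C - N" for c
        using that nonneg[of r c] J by (force simp: N_def A_def)
      then show "(\<Sum>c\<in>C. y r c) = (\<Sum>c\<in>N. y r c)"
        by (intro sum.mono_neutral_right fin(2) N) simp
    qed
    also have "\<dots> = (\<Sum>c\<in>N. \<Sum>r\<in>J. y r c)" by (rule sum.swap)
    also have "\<dots> \<le> (\<Sum>c\<in>N. \<Sum>r\<in>R. y r c)"
      using J N fin nonneg by (intro sum_mono sum_mono2) auto
    also have "\<dots> = real (card N)" using cols N by (simp add: subset_iff)
    finally show "card J \<le> card (\<Union>(A ` J))" by (simp add: N_def)
  qed (use fin in \<open>auto simp: A_def\<close>)
  then obtain \<sigma> where s: "inj_on \<sigma> R" "\<And>r. r \<in> R \<Longrightarrow> \<sigma> r \<in> A r" by blast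
  have "\<sigma> ` R = C"
    using s fin card by (intro card_subset_eq) (auto simp: A_def card_image)
  then show ?thesis using that[of \<sigma>] s by (auto simp: bij_betw_def A_def)
qed

section \<open>From the gap decrease to the bounds\<close>

lemma power_one_minus_inverse_less:
  fixes \<Lambda> :: real
  assumes "1 \<le> \<Lambda>" "\<Lambda> * ln \<Lambda> \<le> real K" "1 \<le> K"
  shows "(1 - 1 / \<Lambda>) ^ K < 1 / \<Lambda>"
proof -
  \<comment> \<open>Strictness comes from \<open>1 - x < exp (- x)\<close> for nonzero
    \<open>x\<close> and survives the power because \<open>K\<close> is positive.\<close>
  have "(1 - 1 / \<Lambda>) ^ K < exp (- (1 / \<Lambda>)) ^ K"
    using assms exp_minus_greater[of "1 / \<Lambda>"] by (intro power_strict_mono) auto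
  also have "\<dots> = exp (- (real K / \<Lambda>))" by (simp flip: exp_of_nat_mult)
  also have "\<dots> \<le> exp (- ln \<Lambda>)" using assms by (simp add: pos_le_divide_eq mult.commute)
  also have "\<dots> = 1 / \<Lambda>" using assms by (simp add: exp_minus inverse_eq_divide)
  finally show ?thesis .
qed

lemma ln_one_minus_le:
  fixes x :: real
  assumes "0 \<le> x" "x < 1"
  shows "ln (1 - x) \<le> - x - x\<^sup>2 / 2"
proof -
  define h where "h t = ln (1 - t) + t + t\<^sup>2 / 2" for t :: real
  have "h x \<le> h 0"
  proof (rule DERIV_nonpos_imp_nonincreasing[OF assms(1)])
    fix t assume t: "0 \<le> t" "t \<le> x"
    then have "t < 1" using assms by simp
    then have "(h has_real_derivative - (1 / (1 - t)) + 1 + t) (at t)"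
      unfolding h_def by (auto intro!: derivative_eq_intros)
    moreover have "- (1 / (1 - t)) + 1 + t = - t\<^sup>2 / (1 - t)"
      using \<open>t < 1\<close> by (simp add: field_simps power2_eq_square)
    then have "- (1 / (1 - t)) + 1 + t \<le> 0" using \<open>t < 1\<close> by (simp add: divide_nonpos_pos)
    ultimately show "\<exists>y. (h has_real_derivative y) (at t) \<and> y \<le> 0" by blast
  qed
  then show ?thesis by (simp add: h_def)
qed

text \<open>A rational bound on e, obtained from \<open>(32 / 31) ^ 32\<close>, reduces numerical
  estimates of logarithms to comparisons of powers.\<close>

lemma exp_of_nat_le: "exp (real n) \<le> (277 / 100) ^ n"
proof -
  have "31 / 32 \<le> exp (- 1 / 32 :: real)" using exp_ge_add_one_self[of "- 1 / 32"] by simp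
  then have "exp (1 / 32 :: real) \<le> 32 / 31" by (simp add: exp_minus field_simps)
  then have "exp (1 / 32 :: real) ^ 32 \<le> (32 / 31) ^ 32" by (intro power_mono) auto
  then have "exp (1 :: real) \<le> 277 / 100" by (simp add: power_divide flip: exp_of_nat_mult)
  then have "exp 1 ^ n \<le> (277 / 100 :: real) ^ n" by (intro power_mono) auto
  moreover have "exp (real n) = exp 1 ^ n" by (simp flip: exp_of_nat_mult)
  ultimately show ?thesis by simp
qed

text \<open>For fractional matchings the number of edges equals the number of nonbasic variables, so the optimal
  vertex itself can only be accounted for by saving one step of the contraction. A second-order bound
  on the logarithm does this for \<open>n \<ge> 5\<close>, rounding up for \<open>n \<le> 4\<close>.\<close>

lemma power_one_minus_inverse_less':
  fixes n :: nat
  assumes n: "2 \<le> n" and K: "2 * real n * ln (2 * real n) \<le> real K"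
  shows "(1 - 1 / (2 * real n)) ^ (K - 1) < 1 / (2 * real n)"
proof -
  define \<Lambda> where "\<Lambda> = 2 * real n"
  have L: "4 \<le> \<Lambda>" using n by (simp add: \<Lambda>_def)
  \<comment> \<open>Such a \<open>j\<close> is smaller than \<open>K\<close>, hence at most
    \<open>K - 1\<close>.\<close>
  have small: ?thesis if "real j < \<Lambda> * ln \<Lambda>" "(1 - 1 / \<Lambda>) ^ j < 1 / \<Lambda>" for j
  proof -
    have "j \<le> K - 1" using that(1) K by (simp add: \<Lambda>_def)
    then have "(1 - 1 / \<Lambda>) ^ (K - 1) \<le> (1 - 1 / \<Lambda>) ^ j" using L by (intro power_decreasing) auto
    then show ?thesis using that(2) by (simp add: \<Lambda>_def)
  qed
  have ln_gt: "real a / real b < ln \<Lambda>" if "0 < b" "(277 / 100) ^ a < \<Lambda> ^ b" for a b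
  proof -
    have "exp (real a) < \<Lambda> ^ b" using exp_of_nat_le[of a] that by simp
    then have "real a < real b * ln \<Lambda>"
      using L by (metis exp_less_cancel_iff exp_ln exp_of_nat_mult less_le_trans zero_less_numeral)
    then show ?thesis using that(1) by (simp add: field_simps)
  qed
  \<comment> \<open>For \<open>n \<le> 4\<close> the exponents 5, 10 and 16 are the integer parts of
    \<open>\<Lambda> ln \<Lambda>\<close> at \<open>\<Lambda> = 4\<close>, 6 and 8.\<close>
  consider "n = 2" | "n = 3" | "n = 4" | "5 \<le> n" using n by linarith
  then show ?thesis
  proof cases
    case 1
    then show ?thesis
      using small[of 5] ln_gt[of 4 5] by (simp add: \<Lambda>_def power_divide)
  next
    case 2
    then show ?thesis
      using small[of 10] ln_gt[of 3 5] by (simp add: \<Lambda>_def power_divide)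
  next
    case 3
    then show ?thesis
      using small[of 16] ln_gt[of 1 2] by (simp add: \<Lambda>_def power_divide)
  next
    case 4
    then have L10: "10 \<le> \<Lambda>" by (simp add: \<Lambda>_def)
    \<comment> \<open>The correction term below is negative exactly when \<open>ln \<Lambda>\<close>
      exceeds \<open>2 + 1 / \<Lambda>\<close>, which is \<open>21 / 10\<close> at
      \<open>\<Lambda> = 10\<close>; this is why the case starts at \<open>n = 5\<close>.\<close>
    have "(277 / 100) ^ 21 < (10 :: real) ^ 10" by (simp add: power_divide)
    also have "\<dots> \<le> \<Lambda> ^ 10" using L10 by (intro power_mono) auto
    finally have ln: "21 / 10 < ln \<Lambda>" using ln_gt[of 10 21] by simp
    have "ln (1 - 1 / \<Lambda>) \<le> - (1 / \<Lambda> + (1 / \<Lambda>)\<^sup>2 / 2)" using ln_one_minus_le[of "1 / \<Lambda>"] L by simp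
    moreover have "\<Lambda> * ln \<Lambda> - 1 \<le> real (K - 1)" using K by (simp add: \<Lambda>_def)
    moreover have "0 \<le> \<Lambda> * ln \<Lambda> - 1"
      using mult_mono[of 10 \<Lambda> "21 / 10" "ln \<Lambda>"] L10 ln by simp
    ultimately have "real (K - 1) * ln (1 - 1 / \<Lambda>) \<le> (\<Lambda> * ln \<Lambda> - 1) * - (1 / \<Lambda> + (1 / \<Lambda>)\<^sup>2 / 2)"
      using L mult_mono[of "\<Lambda> * ln \<Lambda> - 1" "real (K - 1)" "1 / \<Lambda> + (1 / \<Lambda>)\<^sup>2 / 2" "- ln (1 - 1 / \<Lambda>)"]
      unfolding mult_minus_right by simp
    also have "\<dots> = - ln \<Lambda> + (2 + 1 / \<Lambda> - ln \<Lambda>) / (2 * \<Lambda>)"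
      using L by (simp add: field_simps power2_eq_square)
    also have "\<dots> < - ln \<Lambda>"
    proof -
      have "1 / \<Lambda> \<le> 1 / 10" using L10 by (intro divide_left_mono) auto
      then have "2 + 1 / \<Lambda> - ln \<Lambda> < 0" using ln by linarith
      then show ?thesis using L by (simp add: divide_neg_pos)
    qed
    finally have "exp (real (K - 1) * ln (1 - 1 / \<Lambda>)) < exp (- ln \<Lambda>)" by simp
    then show ?thesis
      using L by (simp add: exp_of_nat_mult exp_minus inverse_eq_divide \<Lambda>_def)
  qed
qed

text \<open>A vertex is determined by its support. Hence it suffices to find within the support of every
  point of the polytope that of a point whose nonzero coordinates are at least \<open>\<delta>\<close>.\<close>

lemma visits_at_mostI:
  fixes P :: "('r, 'c) standard_form"
  assumes fin: "finite (row_set P)" "finite (col_set P)"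
    and sum_le: "\<And>x. x \<in> polytope_of P \<Longrightarrow> (\<Sum>j\<in>col_set P. x j) \<le> L"
    and round: "\<And>x. x \<in> polytope_of P \<Longrightarrow>
      \<exists>y\<in>polytope_of P. (\<forall>j. x j = 0 \<longrightarrow> y j = 0) \<and> (\<forall>j. y j = 0 \<or> \<delta> \<le> y j)"
    and delta: "0 < \<delta>" "\<delta> \<le> L" and K: "(1 - \<delta> / L) ^ K < \<delta> / L"
    and N: "\<And>R. R \<subseteq> row_set P \<Longrightarrow> irredundant_form P (P\<lparr>row_set := R\<rparr>) \<Longrightarrow>
      card R \<le> card (col_set P) \<Longrightarrow> int ((card (col_set P) - card R) * K + 1) \<le> N"
  shows "visits_at_most P N"
  unfolding visits_at_most_def
proof (intro allI impI, elim conjE)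
  fix Q c rule Bs
  assume irr: "irredundant_form P Q" and path: "simplex_path rule Q c Bs"
  obtain R where R: "R \<subseteq> row_set P" "Q = P\<lparr>row_set := R\<rparr>"
    using irr unfolding irredundant_form_def by blast
  have Q: "row_set Q = R" "col_set Q = col_set P" by (simp_all add: R)
  have poly: "polytope_of Q = polytope_of P"
    using irr by (simp add: polytope_of_def irredundant_form_def Q)
  interpret finite_lp Q
    by unfold_locales (use fin R(1) Q finite_subset in auto)
  interpret bounded_lp Q L \<delta>
  proof
    show "full_row_rank Q" using irr by (simp add: irredundant_form_def)
    show "(\<Sum>j\<in>col_set Q. x j) \<le> L" if "x \<in> polytope_of Q" for x
      using sum_le that by (simp add: poly Q)
    fix B j assume fB: "feasible_basis Q B" and pos: "0 < basic_solution Q B j"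
    then have B: "is_basis Q B" and "basic_solution Q B \<in> polytope_of P"
      by (simp_all add: feasible_basis_iff poly)
    from round[OF this(2)] obtain y where y: "y \<in> polytope_of P"
      "\<And>j. basic_solution Q B j = 0 \<Longrightarrow> y j = 0" "\<And>j. y j = 0 \<or> \<delta> \<le> y j" by blast
    have "y = basic_solution Q B"
      using y(1) poly by (intro basic_solution_unique[OF B]) (auto simp: polytope_of_def intro: y(2) basic_solution_outside)
    then show "\<delta> \<le> basic_solution Q B j" using y(3)[of j] pos by auto
  qed (fact delta)+
  have B: "is_basis Q (hd Bs)" using path by (simp add: simplex_path_def feasible_basis_def)
  then have "card R = card (hd Bs)" by (simp add: is_basis_def Q)
  also have "\<dots> \<le> card (col_set P)" using card_mono[OF finite_cols basis_subset[OF B]] by (simp add: Q)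
  finally have "card R \<le> card (col_set P)" .
  then have "int ((card (col_set P) - card R) * K + 1) \<le> N" using irr R by (intro N) auto
  moreover have "card (visited_vertices Q Bs) \<le> (card (col_set P) - card R) * K + 1"
    using card_visited_vertices_le[OF path K] by (simp add: Q)
  ultimately show "int (card (visited_vertices Q Bs)) \<le> N" by linarith
qed

text \<open>As 0 is not a solution, at least one equation survives, so there is a basic variable
  whose share \<open>K\<close> pays for the additional 1. The bound \<open>k\<close> may exceed
  \<open>\<Lambda> ln \<Lambda>\<close>, which accommodates the larger logarithms in the stated
  bounds.\<close>

lemma visits_at_most_card_cols:
  fixes P :: "('r, 'c) standard_form"
  assumes fin: "finite (row_set P)" "finite (col_set P)"
    and sum_le: "\<And>x. x \<in> polytope_of P \<Longrightarrow> (\<Sum>j\<in>col_set P. x j) \<le> \<delta> * \<Lambda>"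
    and round: "\<And>x. x \<in> polytope_of P \<Longrightarrow>
      \<exists>y\<in>polytope_of P. (\<forall>j. x j = 0 \<longrightarrow> y j = 0) \<and> (\<forall>j. y j = 0 \<or> \<delta> \<le> y j)"
    and nonzero: "(\<lambda>_. 0) \<notin> solution_set P"
    and delta: "0 < \<delta>" "1 \<le> \<Lambda>" and K: "\<Lambda> * ln \<Lambda> \<le> k" "0 < k"
  shows "visits_at_most P (int (card (col_set P)) * \<lceil>k\<rceil>)"
proof -
  define K where "K = nat \<lceil>k\<rceil>"
  have "0 < \<lceil>k\<rceil>" using \<open>0 < k\<close> by simp
  then have iK: "int K = \<lceil>k\<rceil>" and K1: "1 \<le> K" unfolding K_def by linarith+
  have "k \<le> real K" using iK by (metis le_of_int_ceiling of_int_of_nat_eq)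
  then have less: "(1 - 1 / \<Lambda>) ^ K < 1 / \<Lambda>"
    using delta K K1 by (intro power_one_minus_inverse_less) auto
  have ratio: "\<delta> / (\<delta> * \<Lambda>) = 1 / \<Lambda>" using delta by simp
  show ?thesis
  proof (rule visits_at_mostI[OF fin sum_le round])
    show "(1 - \<delta> / (\<delta> * \<Lambda>)) ^ K < \<delta> / (\<delta> * \<Lambda>)" unfolding ratio by (rule less)
    fix R assume R: "R \<subseteq> row_set P" "irredundant_form P (P\<lparr>row_set := R\<rparr>)" "card R \<le> card (col_set P)"
    have "R \<noteq> {}"
    proof
      assume "R = {}"
      then have "solution_set P = {x. \<forall>j. j \<notin> col_set P \<longrightarrow> x j = 0}"
        using R(2) by (simp add: irredundant_form_def solution_set_def)
      with nonzero show False by simp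
    qed
    then have r: "1 \<le> card R" using R(1) fin(1) finite_subset by (metis One_nat_def Suc_leI card_gt_0_iff)
    have "(card (col_set P) - card R) * K + 1 \<le> (card (col_set P) - card R) * K + card R * K"
      using mult_le_mono[OF r K1] by simp
    also have "\<dots> = card (col_set P) * K" using R(3) by (simp flip: add_mult_distrib)
    finally show "int ((card (col_set P) - card R) * K + 1) \<le> int (card (col_set P)) * \<lceil>k\<rceil>"
      by (simp flip: iK of_nat_mult of_nat_add)
  qed (use delta in auto)
qed

section \<open>Matching polytopes\<close>

lemma bij_betw_incident_edges:
  assumes "simple_graph V E" "u \<in> V"
  shows "bij_betw (\<lambda>v. {u, v}) {v\<in>V - {u}. {u, v} \<in> E} {e\<in>E. u \<in> e}"
proof (rule bij_betwI')
  fix e assume e: "e \<in> {e\<in>E. u \<in> e}"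
  then have "e \<subseteq> V" "card e = 2" "u \<in> e" using assms by (auto simp: simple_graph_def)
  then obtain v where "e = {u, v}" "v \<noteq> u" by (auto simp: card_2_iff)
  with e \<open>e \<subseteq> V\<close> show "\<exists>v\<in>{v\<in>V - {u}. {u, v} \<in> E}. e = {u, v}" by auto
qed (auto simp: doubleton_eq_iff)

text \<open>The slack of a node is placed on the diagonal of a symmetric doubly stochastic matrix, and each
  pair \<open>w, \<sigma> w\<close> of a permutation \<open>\<sigma>\<close> in its support contributes one half of an edge.\<close>

lemma half_integral_rounding:
  fixes x :: "'v set \<Rightarrow> real" and s :: "'v \<Rightarrow> real"
  assumes G: "simple_graph V E" and x: "\<And>e. e \<in> E \<Longrightarrow> 0 \<le> x e" and s: "\<And>v. v \<in> V \<Longrightarrow> 0 \<le> s v"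
    and deg: "\<And>v. v \<in> V \<Longrightarrow> (\<Sum>e\<in>{e\<in>E. v \<in> e}. x e) + s v = 1"
  shows "\<exists>x' s'. (\<forall>e\<in>E. x e = 0 \<longrightarrow> x' e = 0) \<and> (\<forall>v\<in>V. s v = 0 \<longrightarrow> s' v = 0) \<and>
    (\<forall>e. x' e = 0 \<or> 1 / 2 \<le> x' e) \<and> (\<forall>v. s' v = 0 \<or> 1 / 2 \<le> s' v) \<and>
    (\<forall>v\<in>V. (\<Sum>e\<in>{e\<in>E. v \<in> e}. x' e) + s' v = (1 :: real))"
proof -
  have fin: "finite V" "finite E" using G simple_graph_finite by (auto simp: simple_graph_def)
  define y where "y u v = (if u = v then s u else if {u, v} \<in> E then x {u, v} else 0)" for u v
  have row: "(\<Sum>v\<in>V. y u v) = 1" if u: "u \<in> V" for u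
  proof -
    have "(\<Sum>v\<in>V. y u v) = s u + (\<Sum>v\<in>V - {u}. y u v)"
      unfolding sum.remove[OF fin(1) u] by (simp add: y_def)
    also have "(\<Sum>v\<in>V - {u}. y u v) = (\<Sum>v\<in>V - {u}. if {u, v} \<in> E then x {u, v} else 0)"
      by (rule sum.cong) (auto simp: y_def)
    also have "(\<Sum>v\<in>V - {u}. if {u, v} \<in> E then x {u, v} else 0) = (\<Sum>v\<in>{v\<in>V - {u}. {u, v} \<in> E}. x {u, v})"
      using fin by (subst sum.inter_filter) auto
    also have "\<dots> = (\<Sum>e\<in>{e\<in>E. u \<in> e}. x e)"
      by (rule sum.reindex_bij_betw[OF bij_betw_incident_edges[OF G u]])
    finally show ?thesis using deg[OF u] by simp
  qed
  have sym: "y u v = y v u" for u v by (simp add: y_def insert_commute)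
  have col: "(\<Sum>u\<in>V. y u v) = 1" if "v \<in> V" for v using row[OF that] sym by simp
  have nonneg: "0 \<le> y u v" if "u \<in> V" for u v using that x s by (auto simp: y_def)
  obtain \<sigma> where \<sigma>: "bij_betw \<sigma> V V" "\<And>v. v \<in> V \<Longrightarrow> 0 < y v (\<sigma> v)"
    using doubly_stochastic_support[OF fin(1) fin(1) nonneg row col] by blast
  have \<sigma>V: "\<sigma> w \<in> V" if "w \<in> V" for w using \<sigma>(1) that bij_betwE by metis
  have edge: "{w, \<sigma> w} \<in> E \<and> 0 < x {w, \<sigma> w}" if "w \<in> V" "\<sigma> w \<noteq> w" for w
    using \<sigma>(2)[OF that(1)] that(2) by (auto simp: y_def split: if_splits)
  \<comment> \<open>A 2-cycle of \<open>\<sigma>\<close> meets its edge twice and gives it weight 1,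
    longer cycles give their edges weight \<open>1 / 2\<close>, and a fixed point uses the
    slack.\<close>
  define x' :: "'v set \<Rightarrow> real" where "x' e = (\<Sum>w\<in>V. if \<sigma> w \<noteq> w \<and> {w, \<sigma> w} = e then 1 / 2 else 0)" for e
  define s' :: "'v \<Rightarrow> real" where "s' v = (if \<sigma> v = v then 1 else 0)" for v
  show ?thesis
  proof (intro exI[of _ x'] exI[of _ s'] conjI ballI allI impI)
    show "x' e = 0" if "e \<in> E" "x e = 0" for e
      unfolding x'_def using edge that by (intro sum.neutral) fastforce
    show "s' v = 0" if "v \<in> V" "s v = 0" for v
      using \<sigma>(2)[of v] that by (auto simp: s'_def y_def)
    show "x' e = 0 \<or> 1 / 2 \<le> x' e" for e
    proof (cases "\<exists>w\<in>V. \<sigma> w \<noteq> w \<and> {w, \<sigma> w} = e")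
      case True
      then obtain w where w: "w \<in> V" "\<sigma> w \<noteq> w \<and> {w, \<sigma> w} = e" by blast
      have "(if \<sigma> w \<noteq> w \<and> {w, \<sigma> w} = e then 1 / 2 else 0) \<le> x' e"
        unfolding x'_def using w(1) fin by (intro member_le_sum) auto
      then show ?thesis using w(2) by simp
    next
      case False
      then have "x' e = 0" unfolding x'_def by (intro sum.neutral) auto
      then show ?thesis by simp
    qed
    show "s' v = 0 \<or> 1 / 2 \<le> s' v" for v by (simp add: s'_def)
    fix u assume u: "u \<in> V"
    \<comment> \<open>A node \<open>u\<close> that is not fixed receives one half from
      \<open>w = u\<close> and one half from its preimage under \<open>\<sigma>\<close>.\<close>
    have inner: "(\<Sum>e\<in>{e\<in>E. u \<in> e}. if \<sigma> w \<noteq> w \<and> {w, \<sigma> w} = e then 1 / 2 else 0)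
        = (if w = u then if \<sigma> u \<noteq> u then 1 / 2 else 0 else 0)
        + (if \<sigma> w = u then if \<sigma> u \<noteq> u then 1 / 2 else 0 else (0 :: real))" if w: "w \<in> V" for w
    proof (cases "\<sigma> w = w")
      case False
      have inj: "w = u" if "\<sigma> w = u" "\<sigma> u = u"
        using \<sigma>(1) w u that unfolding bij_betw_def by (metis inj_onD)
      have "(\<Sum>e\<in>{e\<in>E. u \<in> e}. if \<sigma> w \<noteq> w \<and> {w, \<sigma> w} = e then 1 / 2 else 0)
          = (\<Sum>e\<in>{e\<in>E. u \<in> e}. if {w, \<sigma> w} = e then 1 / 2 else (0 :: real))"
        using False by simp
      also have "\<dots> = (if u \<in> {w, \<sigma> w} then 1 / 2 else 0)"
        using edge[OF w False] fin by (subst sum.delta') auto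
      finally show ?thesis using False inj by auto
    qed auto
    have "(\<Sum>e\<in>{e\<in>E. u \<in> e}. x' e)
        = (\<Sum>w\<in>V. \<Sum>e\<in>{e\<in>E. u \<in> e}. if \<sigma> w \<noteq> w \<and> {w, \<sigma> w} = e then 1 / 2 else 0)"
      unfolding x'_def by (rule sum.swap)
    also have "\<dots> = (\<Sum>w\<in>V. if w = u then if \<sigma> u \<noteq> u then 1 / 2 else 0 else 0)
        + (\<Sum>w\<in>V. if \<sigma> w = u then if \<sigma> u \<noteq> u then 1 / 2 else 0 else 0)"
      using inner by (simp only: sum.distrib cong: sum.cong)
    also have "(\<Sum>w\<in>V. if \<sigma> w = u then if \<sigma> u \<noteq> u then 1 / 2 else 0 else (0 :: real))
        = (\<Sum>w\<in>V. if w = u then if \<sigma> u \<noteq> u then 1 / 2 else 0 else 0)"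
      by (rule sum.reindex_bij_betw[OF \<sigma>(1)])
    also have "(\<Sum>w\<in>V. if w = u then if \<sigma> u \<noteq> u then 1 / 2 else 0 else (0 :: real))
        = (if \<sigma> u \<noteq> u then 1 / 2 else 0)"
      using u fin by simp
    finally show "(\<Sum>e\<in>{e\<in>E. u \<in> e}. x' e) + s' u = 1" by (simp add: s'_def)
  qed
qed

lemma sum_incident_edges:
  fixes x :: "'v set \<Rightarrow> real"
  assumes G: "simple_graph V E"
  shows "(\<Sum>v\<in>V. \<Sum>e\<in>{e\<in>E. v \<in> e}. x e) = 2 * (\<Sum>e\<in>E. x e)"
proof -
  have fin: "finite V" "finite E" using G simple_graph_finite by (auto simp: simple_graph_def)
  have "(\<Sum>v\<in>V. \<Sum>e\<in>{e\<in>E. v \<in> e}. x e) = (\<Sum>v\<in>V. \<Sum>e\<in>E. if v \<in> e then x e else 0)"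
    using fin by (simp add: sum.inter_filter)
  also have "\<dots> = (\<Sum>e\<in>E. \<Sum>v\<in>V. if v \<in> e then x e else 0)" by (rule sum.swap)
  also have "\<dots> = (\<Sum>e\<in>E. 2 * x e)"
  proof (rule sum.cong[OF refl])
    fix e assume "e \<in> E"
    then have e: "e \<subseteq> V" "card e = 2" using G by (auto simp: simple_graph_def)
    then have "{v\<in>V. v \<in> e} = e" by auto
    then show "(\<Sum>v\<in>V. if v \<in> e then x e else 0) = 2 * x e"
      using fin e by (simp flip: sum.inter_filter)
  qed
  finally show ?thesis by (simp add: sum_distrib_left)
qed

text \<open>Each edge is counted at both ends, so the coordinates sum to \<open>n / 2\<close> and
  \<open>\<Lambda> = n\<close>. The factor 2 in the logarithm keeps it positive at
  \<open>n = 1\<close>.\<close>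

lemma fractional_perfect_matching_bound:
  fixes V :: "'v set"
  assumes G: "simple_graph V E" and ne: "V \<noteq> {}"
  shows "visits_at_most (fractional_perfect_matching_lp V E)
    (int (card E) * \<lceil>real (card V) * ln (2 * real (card V))\<rceil>)"
proof -
  let ?P = "fractional_perfect_matching_lp V E" and ?n = "real (card V)"
  have fin: "finite V" "finite E" using G simple_graph_finite by (auto simp: simple_graph_def)
  have P: "row_set ?P = V" "col_set ?P = E" by (simp_all add: fractional_perfect_matching_lp_def)
  have n: "1 \<le> ?n" using ne fin by (simp add: Suc_leI card_gt_0_iff)
  have "visits_at_most ?P (int (card (col_set ?P)) * \<lceil>?n * ln (2 * ?n)\<rceil>)"
  proof (rule visits_at_most_card_cols[where \<delta> = "1 / 2" and \<Lambda> = ?n])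
    fix x assume "x \<in> polytope_of ?P"
    then have x: "\<And>e. e \<notin> E \<Longrightarrow> x e = 0" "\<And>e. e \<in> E \<Longrightarrow> 0 \<le> x e"
      "\<And>v. v \<in> V \<Longrightarrow> (\<Sum>e\<in>{e\<in>E. v \<in> e}. x e) = 1"
      by (simp_all add: polytope_of_fractional_perfect_matching_lp[OF G])
    show "(\<Sum>e\<in>col_set ?P. x e) \<le> 1 / 2 * ?n"
      using sum_incident_edges[OF G, of x] x(3) by (simp add: P)
    \<comment> \<open>Slacks that are zero stay zero under the rounding, so the rounded point still
      has all degrees equal to 1.\<close>
    have "(\<Sum>e\<in>{e\<in>E. v \<in> e}. x e) + 0 = 1" if "v \<in> V" for v using x(3)[OF that] by simp
    from half_integral_rounding[OF G, of x "\<lambda>_. 0", OF x(2) order_refl this]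
    obtain x' s' where x': "\<forall>e\<in>E. x e = 0 \<longrightarrow> x' e = 0"
      "\<forall>v\<in>V. (0 :: real) = 0 \<longrightarrow> s' v = (0 :: real)" "\<forall>e. x' e = 0 \<or> 1 / 2 \<le> x' e"
      "\<forall>v\<in>V. (\<Sum>e\<in>{e\<in>E. v \<in> e}. x' e) + s' v = 1"
      by blast
    define z where "z e = (if e \<in> E then x' e else 0)" for e
    have "(\<Sum>e\<in>{e\<in>E. v \<in> e}. z e) = 1" if "v \<in> V" for v
      using x'(2,4) that by (simp add: z_def)
    moreover have z: "z e = 0 \<or> 1 / 2 \<le> z e" for e using x'(3) by (simp add: z_def)
    moreover have "0 \<le> z e" for e using z[of e] by auto
    moreover have "z e = 0" if "x e = 0" for e using x'(1) that by (simp add: z_def)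
    moreover have "z e = 0" if "e \<notin> E" for e using that by (simp add: z_def)
    ultimately show "\<exists>y\<in>polytope_of ?P. (\<forall>e. x e = 0 \<longrightarrow> y e = 0) \<and> (\<forall>e. y e = 0 \<or> 1 / 2 \<le> y e)"
      by (intro bexI[of _ z]) (simp_all add: polytope_of_fractional_perfect_matching_lp[OF G])
  next
    show "(\<lambda>_. 0) \<notin> solution_set ?P"
      using ne by (auto simp: solution_set_def fractional_perfect_matching_lp_def)
    show "0 < ?n * ln (2 * ?n)" "?n * ln ?n \<le> ?n * ln (2 * ?n)" using n by simp_all
  qed (use fin P n in auto)
  then show ?thesis by (simp add: P)
qed

text \<open>Edges count twice and slacks once in the sum of the equations, so all coordinates
  together sum to at most \<open>n\<close>, and \<open>\<Lambda> = 2 n\<close>.\<close>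

lemma fractional_matching_bound:
  fixes V :: "'v set"
  assumes G: "simple_graph V E" and ne: "E \<noteq> {}"
  shows "visits_at_most (fractional_matching_lp V E)
    (int (card E) * \<lceil>2 * real (card V) * ln (2 * real (card V))\<rceil>)"
proof -
  let ?P = "fractional_matching_lp V E" and ?n = "real (card V)"
  have fin: "finite V" "finite E" using G simple_graph_finite by (auto simp: simple_graph_def)
  have P: "row_set ?P = V" "col_set ?P = E <+> V" by (simp_all add: fractional_matching_lp_def)
  obtain e where "e \<in> E" using ne by blast
  then have "e \<subseteq> V" "card e = 2" using G by (auto simp: simple_graph_def)
  then have n: "2 \<le> card V" using card_mono[of V e] fin by simp
  define K where "K = nat \<lceil>2 * ?n * ln (2 * ?n)\<rceil>"
  have "0 < 2 * ?n * ln (2 * ?n)" using n by simp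
  then have "0 < \<lceil>2 * ?n * ln (2 * ?n)\<rceil>" by (simp only: zero_less_ceiling)
  then have iK: "int K = \<lceil>2 * ?n * ln (2 * ?n)\<rceil>" and K1: "1 \<le> K" unfolding K_def by linarith+
  have "2 * ?n * ln (2 * ?n) \<le> real K" using iK by (metis le_of_int_ceiling of_int_of_nat_eq)
  from power_one_minus_inverse_less'[OF n this]
  have less: "(1 - 1 / (2 * ?n)) ^ (K - 1) < 1 / (2 * ?n)" .
  show ?thesis
  proof (rule visits_at_mostI[where \<delta> = "1 / 2" and L = ?n and K = "K - 1"])
    show "(1 - 1 / 2 / ?n) ^ (K - 1) < 1 / 2 / ?n" using less by simp
    fix x assume "x \<in> polytope_of ?P"
    then have x: "\<And>j. j \<notin> E <+> V \<Longrightarrow> x j = 0" "\<And>j. j \<in> E <+> V \<Longrightarrow> 0 \<le> x j"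
      "\<And>v. v \<in> V \<Longrightarrow> (\<Sum>e\<in>{e\<in>E. v \<in> e}. x (Inl e)) + x (Inr v) = 1"
      by (simp_all add: polytope_of_fractional_matching_lp[OF G])
    have "2 * (\<Sum>e\<in>E. x (Inl e)) + (\<Sum>v\<in>V. x (Inr v)) = (\<Sum>v\<in>V. 1)"
      using x(3) by (simp flip: sum_incident_edges[OF G] sum.distrib)
    moreover have "0 \<le> (\<Sum>e\<in>E. x (Inl e))" using x(2) by (intro sum_nonneg) auto
    ultimately show "(\<Sum>j\<in>col_set ?P. x j) \<le> ?n" using fin by (simp add: P sum.Plus)
    have "0 \<le> x (Inl e)" if "e \<in> E" for e using x(2) that by auto
    moreover have "0 \<le> x (Inr v)" if "v \<in> V" for v using x(2) that by auto
    ultimately obtain x' s' where x': "\<forall>e\<in>E. x (Inl e) = 0 \<longrightarrow> x' e = 0"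
      "\<forall>v\<in>V. x (Inr v) = 0 \<longrightarrow> s' v = 0" "\<forall>e. x' e = 0 \<or> 1 / 2 \<le> x' e"
      "\<forall>v. s' v = 0 \<or> 1 / 2 \<le> s' v" "\<forall>v\<in>V. (\<Sum>e\<in>{e\<in>E. v \<in> e}. x' e) + s' v = (1 :: real)"
      using half_integral_rounding[OF G _ _ x(3)] by blast
    define z where "z j = (case j of Inl e \<Rightarrow> if e \<in> E then x' e else 0
      | Inr v \<Rightarrow> if v \<in> V then s' v else 0)" for j
    have "(\<Sum>e\<in>{e\<in>E. v \<in> e}. z (Inl e)) + z (Inr v) = 1" if "v \<in> V" for v
      using x'(5) that by (simp add: z_def)
    moreover have z: "z j = 0 \<or> 1 / 2 \<le> z j" for j
      using x'(3,4) by (cases j) (simp_all add: z_def)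
    moreover have "0 \<le> z j" for j using z[of j] by auto
    moreover have "z j = 0" if "x j = 0" for j using x'(1,2) that by (cases j) (auto simp: z_def)
    moreover have "z j = 0" if "j \<notin> E <+> V" for j using that by (cases j) (auto simp: z_def)
    ultimately show "\<exists>y\<in>polytope_of ?P. (\<forall>j. x j = 0 \<longrightarrow> y j = 0) \<and> (\<forall>j. y j = 0 \<or> 1 / 2 \<le> y j)"
      by (intro bexI[of _ z]) (simp_all add: polytope_of_fractional_matching_lp[OF G])
  next
    fix R assume R: "R \<subseteq> row_set ?P" "irredundant_form ?P (?P\<lparr>row_set := R\<rparr>)"
    have "R = V"
    proof (rule ccontr)
      assume "R \<noteq> V"
      then obtain v where v: "v \<in> V" "v \<notin> R" using R(1) by (auto simp: P)
      \<comment> \<open>Each slack variable occurs in one equation only. If the equation of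
        \<open>v\<close> were dropped, the slack of \<open>v\<close> could be 2, so no equation is
        redundant.\<close>
      define z :: "'v set + 'v \<Rightarrow> real" where
        "z j = (case j of Inl e \<Rightarrow> 0 | Inr u \<Rightarrow> if u \<in> V then if u = v then 2 else 1 else 0)" for j
      have row: "(\<Sum>j\<in>col_set ?P. entry ?P u j * z j) = z (Inr u)" if "u \<in> V" for u
      proof -
        have "(\<Sum>w\<in>V. (if w = u then 1 else 0) * z (Inr w)) = (\<Sum>w\<in>V. if w = u then z (Inr w) else 0)"
          by (rule sum.cong) auto
        then show ?thesis using that fin
          by (simp add: P sum.Plus fractional_matching_lp_def z_def)
      qed
      have supp: "z j = 0" if "j \<notin> col_set ?P" for j using that by (cases j) (auto simp: P z_def)
      have "z \<in> solution_set (?P\<lparr>row_set := R\<rparr>)"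
        using row supp v R(1) by (auto simp: solution_set_def P) (auto simp: fractional_matching_lp_def z_def)
      then have "z \<in> solution_set ?P" using R(2) by (simp add: irredundant_form_def)
      then have "z (Inr v) = 1" using row[OF v(1)] v(1)
        by (simp add: solution_set_def P) (simp add: fractional_matching_lp_def)
      then show False using v(1) by (simp add: z_def)
    qed
    then have "card (col_set ?P) - card R = card E" using fin by (simp add: P card_Plus)
    moreover have "card E * (K - 1) + 1 \<le> card E * K"
      using ne fin K1 by (cases K) (simp_all add: Suc_leI card_gt_0_iff)
    ultimately show "int ((card (col_set ?P) - card R) * (K - 1) + 1) \<le> int (card E) * \<lceil>2 * ?n * ln (2 * ?n)\<rceil>"
      by (simp flip: iK of_nat_mult add: of_nat_le_iff[symmetric] del: of_nat_le_iff)
  qed (use fin P n in auto)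
qed

section \<open>The Birkhoff and shortest path polytopes\<close>

text \<open>The entries sum to \<open>n\<close> and the rounded points are permutation matrices, so
  \<open>\<Lambda> = n\<close>. At \<open>n = 1\<close> the logarithm, and with it the bound, would
  be 0.\<close>

lemma birkhoff_bound:
  assumes n: "2 \<le> n"
  shows "visits_at_most (birkhoff_lp n) (int n ^ 2 * \<lceil>real n * ln (2 * real n - 1)\<rceil>)"
proof -
  let ?P = "birkhoff_lp n"
  define N where "N = {1..n}"
  have fin: "finite N" by (simp add: N_def)
  have P: "row_set ?P = N <+> N" "col_set ?P = N \<times> N" by (simp_all add: birkhoff_lp_def N_def)
  have poly: "polytope_of ?P = {x. (\<forall>p. p \<notin> N \<times> N \<longrightarrow> x p = 0) \<and> (\<forall>p\<in>N \<times> N. 0 \<le> x p) \<and>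
        (\<forall>i\<in>N. (\<Sum>j\<in>N. x (i, j)) = 1) \<and> (\<forall>j\<in>N. (\<Sum>i\<in>N. x (i, j)) = 1)}"
    unfolding N_def by (rule polytope_of_birkhoff_lp)
  have "visits_at_most ?P (int (card (col_set ?P)) * \<lceil>real n * ln (2 * real n - 1)\<rceil>)"
  proof (rule visits_at_most_card_cols[where \<delta> = 1 and \<Lambda> = "real n"])
    fix x assume "x \<in> polytope_of ?P"
    then have x: "\<And>i j. i \<in> N \<Longrightarrow> j \<in> N \<Longrightarrow> 0 \<le> x (i, j)"
      "\<And>i. i \<in> N \<Longrightarrow> (\<Sum>j\<in>N. x (i, j)) = 1" "\<And>j. j \<in> N \<Longrightarrow> (\<Sum>i\<in>N. x (i, j)) = 1"
      by (simp_all add: poly)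
    have "(\<Sum>p\<in>N \<times> N. x p) = (\<Sum>i\<in>N. \<Sum>j\<in>N. x (i, j))"
      by (simp add: sum.cartesian_product)
    also have "\<dots> = real n" using x(2) by (simp add: N_def)
    finally show "(\<Sum>p\<in>col_set ?P. x p) \<le> 1 * real n" by (simp add: P)
    obtain \<sigma> where \<sigma>: "bij_betw \<sigma> N N" "\<And>i. i \<in> N \<Longrightarrow> 0 < x (i, \<sigma> i)"
      using doubly_stochastic_support[OF fin fin, of "\<lambda>i j. x (i, j)", OF x] by blast
    have \<sigma>N: "\<sigma> i \<in> N" if "i \<in> N" for i using \<sigma>(1) that bij_betwE by metis
    define z where "z p = (if fst p \<in> N \<and> \<sigma> (fst p) = snd p then 1 else 0 :: real)" for p
    have "(\<Sum>j\<in>N. z (i, j)) = 1" if "i \<in> N" for i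
      using that \<sigma>N fin by (simp add: z_def)
    moreover have "(\<Sum>i\<in>N. z (i, j)) = 1" if j: "j \<in> N" for j
    proof -
      have "(\<Sum>i\<in>N. z (i, j)) = (\<Sum>i\<in>N. if \<sigma> i = j then 1 else 0)"
        by (rule sum.cong) (auto simp: z_def)
      also have "\<dots> = (\<Sum>i\<in>N. if i = j then 1 else 0)" by (rule sum.reindex_bij_betw[OF \<sigma>(1)])
      finally show ?thesis using j fin by simp
    qed
    moreover have "z p = 0" if "x p = 0" for p using \<sigma>(2)[of "fst p"] that by (auto simp: z_def)
    moreover have "z p = 0" if "p \<notin> N \<times> N" for p using \<sigma>N that by (cases p) (auto simp: z_def)
    moreover have "0 \<le> z p" "z p = 0 \<or> 1 \<le> z p" for p by (simp_all add: z_def)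
    ultimately show "\<exists>y\<in>polytope_of ?P. (\<forall>p. x p = 0 \<longrightarrow> y p = 0) \<and> (\<forall>p. y p = 0 \<or> 1 \<le> y p)"
      by (intro bexI[of _ z]) (simp_all add: poly)
  next
    have "Inl 1 \<in> row_set ?P" "rhs ?P (Inl 1) = 1" using n by (auto simp: birkhoff_lp_def)
    then show "(\<lambda>_. 0) \<notin> solution_set ?P" by (force simp: solution_set_def)
    show "real n * ln (real n) \<le> real n * ln (2 * real n - 1)" "0 < real n * ln (2 * real n - 1)"
      using n by simp_all
  qed (use fin P n in auto)
  then show ?thesis by (simp add: P N_def power2_eq_square)
qed

text \<open>Splitting each inner node into an exit (row) and an entrance (column), with its slack variable
  on the diagonal, turns the points of the shortest path polytope into doubly stochastic matrices.\<close>

lemma shortest_path_bound: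
  assumes n: "3 \<le> n"
  shows "visits_at_most (shortest_path_lp n)
    ((int n ^ 2 - 2 * int n + 1) * \<lceil>(real n - 1) * ln (real n - 1)\<rceil>)"
proof -
  let ?P = "shortest_path_lp n"
  define R where "R = {1..n - 1}"
  define C where "C = {2..n}"
  define M where "M = {2..n - 1}"
  define arcs where "arcs = {(i, j). i \<in> R \<and> j \<in> C \<and> i \<noteq> j}"
  have sets: "R = insert 1 M" "1 \<notin> M" "C = insert n M" "n \<notin> M" "n \<notin> R" "1 \<notin> C" "1 \<in> R" "n \<in> C"
    using n by (auto simp: R_def C_def M_def)
  have fin: "finite R" "finite C" "finite M" by (simp_all add: R_def C_def M_def)
  have "arcs \<subseteq> R \<times> C" by (auto simp: arcs_def)
  then have fin_arcs: "finite arcs" using fin by (simp add: finite_subset)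
  have P: "row_set ?P = R <+> M" "col_set ?P = arcs <+> M"
    by (simp_all add: shortest_path_lp_def R_def C_def M_def arcs_def)
  have poly: "polytope_of ?P =
    {x. (\<forall>v. v \<notin> arcs <+> M \<longrightarrow> x v = 0) \<and> (\<forall>v\<in>arcs <+> M. 0 \<le> x v) \<and>
        (\<forall>k\<in>R. (\<Sum>a\<in>{a\<in>arcs. fst a = k}. x (Inl a)) - (\<Sum>a\<in>{a\<in>arcs. snd a = k}. x (Inl a))
           = (if k = 1 then 1 else 0)) \<and>
        (\<forall>k\<in>M. (\<Sum>a\<in>{a\<in>arcs. fst a = k}. x (Inl a)) + x (Inr k) = 1)}"
    unfolding arcs_def R_def C_def M_def by (rule polytope_of_shortest_path_lp)
  have out_arcs: "(\<Sum>a\<in>{a\<in>arcs. fst a = k}. f a) = (\<Sum>j\<in>C - {k}. f (k, j))" if "k \<in> R"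
    for k and f :: "nat \<times> nat \<Rightarrow> real"
  proof -
    have "{a\<in>arcs. fst a = k} = Pair k ` (C - {k})" using that by (auto simp: arcs_def)
    then show ?thesis by (simp add: sum.reindex inj_on_def)
  qed
  have in_arcs: "(\<Sum>a\<in>{a\<in>arcs. snd a = k}. f a) = (\<Sum>i\<in>R - {k}. f (i, k))" if "k \<in> C"
    for k and f :: "nat \<times> nat \<Rightarrow> real"
  proof -
    have "{a\<in>arcs. snd a = k} = (\<lambda>i. (i, k)) ` (R - {k})" using that by (auto simp: arcs_def)
    then show ?thesis by (simp add: sum.reindex inj_on_def)
  qed
  have no_in: "(\<Sum>a\<in>{a\<in>arcs. snd a = 1}. f a) = 0" for f :: "nat \<times> nat \<Rightarrow> real"
    using sets(6) by (intro sum.neutral) (auto simp: arcs_def)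
  have card_cols: "int (card (col_set ?P)) = int n ^ 2 - 2 * int n + 1"
  proof -
    \<comment> \<open>The loops missing from the full rectangle are those at inner nodes, and their
      number is made up by the slack variables.\<close>
    have "arcs = R \<times> C - (\<lambda>i. (i, i)) ` M" using sets by (auto simp: arcs_def)
    moreover have "(\<lambda>i. (i, i)) ` M \<subseteq> R \<times> C" using sets by auto
    moreover have "card ((\<lambda>i. (i, i)) ` M) = card M" by (rule card_image) (simp add: inj_on_def)
    ultimately have "card arcs = card (R \<times> C) - card M" "card M \<le> card (R \<times> C)"
      using fin card_mono[of "R \<times> C" "(\<lambda>i. (i, i)) ` M"] by (simp_all add: card_Diff_subset)
    then have "card (col_set ?P) = card R * card C"
      using fin fin_arcs by (simp add: P card_Plus card_cartesian_product)
    also have "\<dots> = (n - 1) * (n - 1)" by (simp add: R_def C_def)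
    finally have "int (card (col_set ?P)) = int (n - 1) * int (n - 1)" by (simp only: of_nat_mult)
    moreover have "int (n - 1) = int n - 1" using n by simp
    ultimately show ?thesis by (simp add: algebra_simps power2_eq_square)
  qed
  have "visits_at_most ?P (int (card (col_set ?P)) * \<lceil>(real n - 1) * ln (real n - 1)\<rceil>)"
  proof (rule visits_at_most_card_cols[where \<delta> = 1 and \<Lambda> = "real n - 1"])
    fix x assume "x \<in> polytope_of ?P"
    then have x: "\<And>v. v \<notin> arcs <+> M \<Longrightarrow> x v = 0" "\<And>v. v \<in> arcs <+> M \<Longrightarrow> 0 \<le> x v"
      and flow: "\<And>k. k \<in> R \<Longrightarrow> (\<Sum>a\<in>{a\<in>arcs. fst a = k}. x (Inl a)) -
        (\<Sum>a\<in>{a\<in>arcs. snd a = k}. x (Inl a)) = (if k = 1 then 1 else 0)"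
      and cap: "\<And>k. k \<in> M \<Longrightarrow> (\<Sum>a\<in>{a\<in>arcs. fst a = k}. x (Inl a)) + x (Inr k) = 1"
      by (simp_all add: poly)
    have out1: "(\<Sum>a\<in>{a\<in>arcs. fst a = 1}. x (Inl a)) = 1"
      using flow[OF sets(7)] no_in[of "\<lambda>a. x (Inl a)"] by (simp only: diff_0_right if_True simp_thms)
    have cardR: "real (card R) = real n - 1" "card R = card C" "real (card M) = real n - 2"
      using n by (simp_all add: R_def C_def M_def of_nat_diff)
    \<comment> \<open>Grouped by tails: node 1 sends out 1, and each of the \<open>n - 2\<close>
      inner nodes contributes 1 together with its slack.\<close>
    have "(\<Sum>a\<in>arcs. x (Inl a)) = (\<Sum>k\<in>R. \<Sum>a\<in>{a\<in>arcs. fst a = k}. x (Inl a))"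
      by (rule sum.group[symmetric]) (use fin fin_arcs in \<open>auto simp: arcs_def\<close>)
    also have "\<dots> = 1 + (\<Sum>k\<in>M. \<Sum>a\<in>{a\<in>arcs. fst a = k}. x (Inl a))"
      using sets(2) fin(3) out1 by (simp add: sets(1))
    finally have "(\<Sum>v\<in>col_set ?P. x v) = 1 + (\<Sum>k\<in>M. (\<Sum>a\<in>{a\<in>arcs. fst a = k}. x (Inl a)) + x (Inr k))"
      using fin fin_arcs by (simp add: P sum.Plus sum.distrib)
    also have "\<dots> = real n - 1" using cap cardR(3) by simp
    finally show "(\<Sum>v\<in>col_set ?P. x v) \<le> 1 * (real n - 1)" by simp
    define y where "y i j = (if i = j then x (Inr i) else x (Inl (i, j)))" for i j
    have y_off: "(\<Sum>j\<in>A - {k}. y k j) = (\<Sum>j\<in>A - {k}. x (Inl (k, j)))"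
      "(\<Sum>i\<in>A - {k}. y i k) = (\<Sum>i\<in>A - {k}. x (Inl (i, k)))" for A k
      by (auto simp: y_def intro!: sum.cong)
    have row: "(\<Sum>j\<in>C. y i j) = 1" if i: "i \<in> R" for i
    proof (cases "i = 1")
      case True
      then have "C - {i} = C" using sets by blast
      then show ?thesis using y_off(1)[of i C] out_arcs[OF i, of "\<lambda>a. x (Inl a)"] out1 True by simp
    next
      case False
      then have iM: "i \<in> M" "i \<in> C" using i sets by auto
      have "(\<Sum>j\<in>C. y i j) = y i i + (\<Sum>j\<in>C - {i}. y i j)" by (rule sum.remove[OF fin(2) iM(2)])
      also have "\<dots> = x (Inr i) + (\<Sum>a\<in>{a\<in>arcs. fst a = i}. x (Inl a))"
        using y_off(1)[of i C] out_arcs[OF i, of "\<lambda>a. x (Inl a)"] by (simp add: y_def)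
      finally show ?thesis using cap[OF iM(1)] by simp
    qed
    have col_M: "(\<Sum>i\<in>R. y i j) = 1" if j: "j \<in> M" for j
    proof -
      have jRC: "j \<in> R" "j \<in> C" "j \<noteq> 1" using j sets by auto
      have "(\<Sum>i\<in>R. y i j) = y j j + (\<Sum>i\<in>R - {j}. y i j)" by (rule sum.remove[OF fin(1) jRC(1)])
      also have "\<dots> = x (Inr j) + (\<Sum>a\<in>{a\<in>arcs. snd a = j}. x (Inl a))"
        using y_off(2)[of j R] in_arcs[OF jRC(2), of "\<lambda>a. x (Inl a)"] by (simp add: y_def)
      finally show ?thesis using flow[OF jRC(1)] cap[OF j] jRC(3) by simp
    qed
    \<comment> \<open>Node \<open>n\<close> has no equation of its own; its column sum follows from
      the total.\<close>
    have "(\<Sum>j\<in>C. \<Sum>i\<in>R. y i j) = (\<Sum>i\<in>R. \<Sum>j\<in>C. y i j)" by (rule sum.swap)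
    also have "\<dots> = real n - 1" using row cardR by simp
    finally have "(\<Sum>i\<in>R. y i n) + (\<Sum>j\<in>M. \<Sum>i\<in>R. y i j) = real n - 1"
      using sets(4) fin(3) by (simp add: sets(3))
    then have "(\<Sum>i\<in>R. y i n) = 1" using col_M cardR(3) by simp
    with col_M have col: "(\<Sum>i\<in>R. y i j) = 1" if "j \<in> C" for j using that sets(3) by auto
    have nonneg: "0 \<le> y i j" if "i \<in> R" "j \<in> C" for i j
      using x(2) that sets by (auto simp: y_def arcs_def)
    obtain \<sigma> where \<sigma>: "bij_betw \<sigma> R C" "\<And>i. i \<in> R \<Longrightarrow> 0 < y i (\<sigma> i)"
      using doubly_stochastic_support[OF fin(1,2) nonneg row col] by blast
    have \<sigma>C: "\<sigma> i \<in> C" if "i \<in> R" for i using \<sigma>(1) that bij_betwE by metis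
    \<comment> \<open>Following \<open>\<sigma>\<close> from node 1 traces a path to
      \<open>n\<close>. The remaining nodes are fixed points, which use their slack, or lie on
      directed cycles, which the system admits.\<close>
    define z :: "nat \<times> nat + nat \<Rightarrow> real" where
      "z v = (case v of Inl a \<Rightarrow> if a \<in> arcs \<and> \<sigma> (fst a) = snd a then 1 else 0
        | Inr k \<Rightarrow> if k \<in> M \<and> \<sigma> k = k then 1 else 0)" for v
    have z_out: "(\<Sum>a\<in>{a\<in>arcs. fst a = k}. z (Inl a)) = (if \<sigma> k = k then 0 else 1)" if k: "k \<in> R" for k
    proof -
      have "(\<Sum>j\<in>C - {k}. z (Inl (k, j))) = (\<Sum>j\<in>C - {k}. if \<sigma> k = j then 1 else 0)"
        using k by (intro sum.cong) (auto simp: z_def arcs_def)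
      also have "\<dots> = (if \<sigma> k = k then 0 else 1)" using \<sigma>C[OF k] fin by (simp add: sum.delta)
      finally show ?thesis using out_arcs[OF k, of "\<lambda>a. z (Inl a)"] by simp
    qed
    have z_in: "(\<Sum>a\<in>{a\<in>arcs. snd a = k}. z (Inl a)) = (if \<sigma> k = k then 0 else 1)" if k: "k \<in> M" for k
    proof -
      have kRC: "k \<in> R" "k \<in> C" using k sets by auto
      have "(\<Sum>i\<in>R - {k}. z (Inl (i, k))) = (\<Sum>i\<in>R - {k}. if \<sigma> i = k then 1 else 0)"
        using kRC by (intro sum.cong) (auto simp: z_def arcs_def)
      also have "\<dots> = (\<Sum>i\<in>R. if \<sigma> i = k then 1 else 0) - (if \<sigma> k = k then 1 else 0)"
        using sum.remove[OF fin(1) kRC(1), of "\<lambda>i. if \<sigma> i = k then 1 else 0 :: real"] by simp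
      also have "(\<Sum>i\<in>R. if \<sigma> i = k then 1 else 0 :: real) = (\<Sum>j\<in>C. if j = k then 1 else 0)"
        by (rule sum.reindex_bij_betw[OF \<sigma>(1)])
      also have "\<dots> = 1" using kRC fin by simp
      finally show ?thesis using in_arcs[OF kRC(2), of "\<lambda>a. z (Inl a)"] by simp
    qed
    have "(\<Sum>a\<in>{a\<in>arcs. fst a = k}. z (Inl a)) - (\<Sum>a\<in>{a\<in>arcs. snd a = k}. z (Inl a))
        = (if k = 1 then 1 else 0)" if k: "k \<in> R" for k
    proof (cases "k = 1")
      case True
      then have "\<sigma> k \<noteq> k" using \<sigma>C[OF k] sets by metis
      then show ?thesis using z_out[OF k] no_in[of "\<lambda>a. z (Inl a)"] True by (simp only: diff_0_right if_True if_False simp_thms)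
    next
      case False
      then have "k \<in> M" using k sets by blast
      then show ?thesis using z_out[OF k] z_in False by simp
    qed
    moreover have "(\<Sum>a\<in>{a\<in>arcs. fst a = k}. z (Inl a)) + z (Inr k) = 1" if "k \<in> M" for k
      using z_out[of k] that sets by (simp add: z_def)
    moreover have "z v = 0" if "x v = 0" for v
      using \<sigma>(2) that sets(1) by (cases v) (force simp: z_def y_def arcs_def)+
    moreover have "z v = 0" if "v \<notin> arcs <+> M" for v using that by (cases v) (auto simp: z_def)
    moreover have "0 \<le> z v" "z v = 0 \<or> 1 \<le> z v" for v by (simp_all add: z_def split: sum.split)
    ultimately show "\<exists>y\<in>polytope_of ?P. (\<forall>v. x v = 0 \<longrightarrow> y v = 0) \<and> (\<forall>v. y v = 0 \<or> 1 \<le> y v)"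
      by (intro bexI[of _ z]) (simp_all add: poly)
  next
    have "Inl 1 \<in> row_set ?P" "rhs ?P (Inl 1) = 1" using n by (auto simp: shortest_path_lp_def)
    then show "(\<lambda>_. 0) \<notin> solution_set ?P" by (force simp: solution_set_def)
    \<comment> \<open>At \<open>n = 2\<close> the logarithm would vanish; this is where
      \<open>n \<ge> 3\<close> matters.\<close>
    show "0 < (real n - 1) * ln (real n - 1)" using n by simp
  qed (use fin fin_arcs P n in auto)
  then show ?thesis by (simp only: card_cols)
qed

section \<open>Complete graphs and asymptotics\<close>

lemma card_complete_edges: "real (card (complete_edges {1..n :: nat})) = real n * (real n - 1) / 2"
proof -
  have "card (complete_edges {1..n}) = n choose 2"
    using n_subsets[of "{1..n}" 2] by (simp add: complete_edges_def)
  also have "\<dots> = n * (n - 1) div 2" by (rule choose_two)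
  finally show ?thesis
    by (cases n) (auto simp: real_of_nat_div algebra_simps)
qed

theorem theorem1p9:
  shows
    "(\<forall>(V :: 'v set) E. simple_graph V E \<and> V \<noteq> {} \<longrightarrow>
        visits_at_most (fractional_perfect_matching_lp V E)
          (int (card E) * \<lceil>real (card V) * ln (2 * real (card V))\<rceil>)) \<and>
     (\<lambda>n. real (card (complete_edges {1..n})) * of_int \<lceil>real n * ln (2 * real n)\<rceil>)
        \<sim>[at_top] (\<lambda>n. real n ^ 3 / 2 * ln (real n)) \<and>

     (\<forall>(V :: 'v set) E. simple_graph V E \<and> E \<noteq> {} \<longrightarrow>
        visits_at_most (fractional_matching_lp V E)
          (int (card E) * \<lceil>2 * real (card V) * ln (2 * real (card V))\<rceil>)) \<and>
     (\<lambda>n. real (card (complete_edges {1..n})) * of_int \<lceil>2 * real n * ln (2 * real n)\<rceil>)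
        \<sim>[at_top] (\<lambda>n. real n ^ 3 * ln (real n)) \<and>

     (\<forall>n \<ge> 2. visits_at_most (birkhoff_lp n)
        (int n ^ 2 * \<lceil>real n * ln (2 * real n - 1)\<rceil>)) \<and>
     (\<lambda>n. real n ^ 2 * of_int \<lceil>real n * ln (2 * real n - 1)\<rceil>)
        \<sim>[at_top] (\<lambda>n. real n ^ 3 * ln (real n)) \<and>

     (\<forall>n \<ge> 3. visits_at_most (shortest_path_lp n)
        ((int n ^ 2 - 2 * int n + 1) * \<lceil>(real n - 1) * ln (real n - 1)\<rceil>)) \<and>
     (\<lambda>n. (real n ^ 2 - 2 * real n + 1) * of_int \<lceil>(real n - 1) * ln (real n - 1)\<rceil>)
        \<sim>[at_top] (\<lambda>n. real n ^ 3 * ln (real n))"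
  unfolding card_complete_edges
proof (intro conjI allI impI)
  show "(\<lambda>n. real n * (real n - 1) / 2 * of_int \<lceil>real n * ln (2 * real n)\<rceil>)
      \<sim>[at_top] (\<lambda>n. real n ^ 3 / 2 * ln (real n))" by real_asymp
  show "(\<lambda>n. real n * (real n - 1) / 2 * of_int \<lceil>2 * real n * ln (2 * real n)\<rceil>)
      \<sim>[at_top] (\<lambda>n. real n ^ 3 * ln (real n))" by real_asymp
  show "(\<lambda>n. real n ^ 2 * of_int \<lceil>real n * ln (2 * real n - 1)\<rceil>)
      \<sim>[at_top] (\<lambda>n. real n ^ 3 * ln (real n))" by real_asymp
  show "(\<lambda>n. (real n ^ 2 - 2 * real n + 1) * of_int \<lceil>(real n - 1) * ln (real n - 1)\<rceil>)
      \<sim>[at_top] (\<lambda>n. real n ^ 3 * ln (real n))" by real_asymp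
qed (blast intro: fractional_perfect_matching_bound fractional_matching_bound birkhoff_bound
    shortest_path_bound)+

end
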